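(* Consider the singularly perturbed control system $$\dot x=f(x,z,u),\qquad \mu\dot z=g(x,z,u),$$ with $x\in B_x\subset\mathbb R^n$, $z\in B_z\subset\mathbb R^m$ ($B_x,B_z$ compact), $u\in\mathbb R$, $\mu\in[0,1]$, where $g(x,z,u)=0$ has a root denoted $z_{ds}=h(x,u_1)$ ($u_1$ being the part of the control $u$ which remains once $z$ has reached the root), and $f,g,h$ are smooth and Lipschitz in their arguments. Assume: (i) there exist a smooth function $u_1(x)$ and a metric $\Theta_x$ such that the reduced system $\dot x=f(x,h(x,u_1),u_1)$ is contracting; (ii) there exist a control law $u_2(x,z)$ satisfying $\|u_2\|\le d_2\|z-h(x,u_1)\|$ in $B_x\times B_z$ and a metric $\Theta_z$ such that the system $\mu\dot z=g(x,z,u_1+u_2)$ is partially contracting in $z$; (iii) $\left\|\frac{\partial Q(x,z)}{\partial z}\right\|\le d_q$, where $Q(x,z)=\frac{\partial h(x,u_1)}{\partial x}f(x,z,u)$ and $d_q$ is a positive constant. Then there exist a control law $u$ and a small constant $\mu^*>0$ such that the closed-loop system is contracting in $B_x\times B_z$ for all $\mu\le\mu^*$.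
   Context: Norms are Euclidean for vectors and induced for matrices. A metric $\Theta$ is a symmetric positive definite (nonsingular) matrix, possibly depending on state and time. Contraction: a system $\dot x=f(x,t)$ is contracting in a region with metric $\Theta$ and rate $\lambda>0$ if, in that region and for all $t>0$, $\left(\dot\Theta+\Theta\frac{\partial f}{\partial x}\right)\Theta^{-1}\le-\lambda I$; equivalently, with $M=\Theta^T\Theta$ uniformly positive definite, $\dot M+M\frac{\partial f}{\partial x}+\frac{\partial f}{\partial x}^TM\le-2\lambda M$. The trajectories of a contracting system starting in the contraction region converge to each other exponentially. Partial contraction: a system $\dot x=f(x,y,t)$ is partially contracting in $x$ if the auxiliary system $\dot w=f(w,y,t)$ is contracting (in $w$) for any value of $y$ and all $t>0$.
   Formalization: It is additionally assumed that h(x,u_1) is the only root in B_z of g(x,z,u_1+u_2)=0 for x in B_x, that B_x lies in the closure of its interior, and that u_2 is smooth; the first two are needed for the claim to be true. The claim is stated for 0<μ≤μ*. *)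

theory Defs
  imports "HOL-Analysis.Analysis"
begin

text \<open>
  \<open>C\<^sup>k\<close> maps on an open set \<open>U\<close>, by iterated Frechet derivatives. The spaces
  below are finite-dimensional, so continuity of all directional derivatives is the
  usual notion. A map is \<open>C\<^sup>k\<close> (smooth) on an arbitrary set \<open>S\<close> if it is so on some
  open neighbourhood of \<open>S\<close>; its derivatives at the points of \<open>S\<close> are then
  ordinary two-sided derivatives, boundary points included.
\<close>

primrec Ck_on_open ::
  "nat \<Rightarrow> ('a::real_normed_vector \<Rightarrow> 'b::real_normed_vector) \<Rightarrow> 'a set \<Rightarrow> bool" where
  "Ck_on_open 0 f U \<longleftrightarrow> continuous_on U f"
| "Ck_on_open (Suc k) f U \<longleftrightarrow>
     f differentiable_on U \<and> (\<forall>v. Ck_on_open k (\<lambda>x. frechet_derivative f (at x) v) U)"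

definition C1_on :: "('a::real_normed_vector \<Rightarrow> 'b::real_normed_vector) \<Rightarrow> 'a set \<Rightarrow> bool" where
  "C1_on f S \<longleftrightarrow> (\<exists>U. open U \<and> S \<subseteq> U \<and> Ck_on_open 1 f U)"

definition smooth_on :: "('a::real_normed_vector \<Rightarrow> 'b::real_normed_vector) \<Rightarrow> 'a set \<Rightarrow> bool" where
  "smooth_on f S \<longleftrightarrow> (\<exists>U. open U \<and> S \<subseteq> U \<and> (\<forall>k. Ck_on_open k f U))"

text \<open>
  Square matrices are rendered as linear operators \<open>'a \<Rightarrow>\<^sub>L 'a\<close> of a Euclidean
  space, so that the same notions apply to the state \<open>x\<close>, to \<open>z\<close> and to the pair \<open>(x, z)\<close>.
  A metric is a \<open>C\<^sup>1\<close> field of symmetric positive definite operators \<open>\<Theta>\<close>, indexed by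
  parameters (states, time) ranging over \<open>P\<close>, for which \<open>M = \<Theta>\<^sup>T \<Theta>\<close> is uniformly
  positive definite; note \<open>v\<^sup>T M v = (\<Theta> v) \<bullet> (\<Theta> v)\<close>. No upper bound on \<open>\<Theta>\<close> is imposed.
\<close>

definition metric_on :: "('p::real_normed_vector \<Rightarrow> 'a::euclidean_space \<Rightarrow>\<^sub>L 'a) \<Rightarrow> 'p set \<Rightarrow> bool" where
  "metric_on \<Theta> P \<longleftrightarrow>
     C1_on \<Theta> P \<and>
     (\<forall>p\<in>P. \<forall>v w. blinfun_apply (\<Theta> p) v \<bullet> w = v \<bullet> blinfun_apply (\<Theta> p) w) \<and>
     (\<forall>p\<in>P. \<forall>v. v \<noteq> 0 \<longrightarrow> v \<bullet> blinfun_apply (\<Theta> p) v > 0) \<and>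
     (\<exists>\<epsilon>>0. \<forall>p\<in>P. \<forall>v.
        \<epsilon> * (v \<bullet> v) \<le> blinfun_apply (\<Theta> p) v \<bullet> blinfun_apply (\<Theta> p) v)"

text \<open>The derivative of \<open>\<Theta>\<close> along the vector field \<open>F\<close>, i.e. \<open>\<partial>\<Theta>/\<partial>x F + \<partial>\<Theta>/\<partial>t\<close>.\<close>

definition metric_rate ::
  "('a \<Rightarrow> real \<Rightarrow> 'a) \<Rightarrow> ('a::euclidean_space \<Rightarrow> real \<Rightarrow> 'a \<Rightarrow>\<^sub>L 'a) \<Rightarrow> 'a \<Rightarrow> real \<Rightarrow> 'a \<Rightarrow>\<^sub>L 'a" where
  "metric_rate F \<Theta> x t = frechet_derivative (\<lambda>(\<xi>, \<tau>). \<Theta> \<xi> \<tau>) (at (x, t)) (F x t, 1)"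

text \<open>
  Contraction of \<open>x' = F x t\<close> in the region \<open>S\<close> with metric \<open>\<Theta>\<close> and rate \<open>l\<close>:
  \<open>(\<Theta>' + \<Theta> \<partial>F/\<partial>x) \<Theta>\<^sup>-\<^sup>1 \<le> - l I\<close> on \<open>S\<close> for all \<open>t > 0\<close>. As the left-hand side need
  not be symmetric, the matrix inequality is that of the quadratic forms.
\<close>

definition contracting_in ::
  "('a \<Rightarrow> real \<Rightarrow> 'a) \<Rightarrow> 'a set \<Rightarrow> ('a::euclidean_space \<Rightarrow> real \<Rightarrow> 'a \<Rightarrow>\<^sub>L 'a) \<Rightarrow> real \<Rightarrow> bool" where
  "contracting_in F S \<Theta> l \<longleftrightarrow>
     l > 0 \<and>
     metric_on (\<lambda>(x, t). \<Theta> x t) (S \<times> {0<..}) \<and>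
     (\<forall>x\<in>S. \<forall>t>0. (\<lambda>\<xi>. F \<xi> t) differentiable (at x)) \<and>
     (\<forall>x\<in>S. \<forall>t>0. \<forall>v.
        let w = inv (blinfun_apply (\<Theta> x t)) v;
            J = frechet_derivative (\<lambda>\<xi>. F \<xi> t) (at x)
        in v \<bullet> (blinfun_apply (metric_rate F \<Theta> x t) w + blinfun_apply (\<Theta> x t) (J w))
             \<le> - l * (v \<bullet> v))"

text \<open>
  Partial contraction of \<open>w' = F w y t\<close> in \<open>w \<in> S\<close>: contraction of the auxiliary system for
  every (frozen) value \<open>y \<in> Y\<close>. The metric may depend on \<open>y\<close> as well, in a jointly
  \<open>C\<^sup>1\<close> way and with a common lower bound.
\<close>

definition partially_contracting_in ::
  "('a \<Rightarrow> 'b \<Rightarrow> real \<Rightarrow> 'a) \<Rightarrow> 'b set \<Rightarrow> 'a set \<Rightarrow>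
   ('b::real_normed_vector \<Rightarrow> 'a::euclidean_space \<Rightarrow> real \<Rightarrow> 'a \<Rightarrow>\<^sub>L 'a) \<Rightarrow> real \<Rightarrow> bool" where
  "partially_contracting_in F Y S \<Theta> l \<longleftrightarrow>
     metric_on (\<lambda>(y, w, t). \<Theta> y w t) (Y \<times> S \<times> {0<..}) \<and>
     (\<forall>y\<in>Y. contracting_in (\<lambda>w t. F w y t) S (\<Theta> y) l)"

text \<open>
  \<open>x' = f x z u\<close>, \<open>\<mu> z' = g x z u\<close> under the feedback \<open>u = u x z\<close>, as a vector field; meant for \<open>\<mu> > 0\<close>.
\<close>

definition closed_loop ::
  "('a \<Rightarrow> 'b \<Rightarrow> real \<Rightarrow> 'a) \<Rightarrow> ('a \<Rightarrow> 'b \<Rightarrow> real \<Rightarrow> 'b::real_vector) \<Rightarrow> ('a \<Rightarrow> 'b \<Rightarrow> real) \<Rightarrow>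
   real \<Rightarrow> 'a \<times> 'b \<Rightarrow> 'a \<times> 'b" where
  "closed_loop f g u \<mu> = (\<lambda>(x, z). (f x z (u x z), (1 / \<mu>) *\<^sub>R g x z (u x z)))"

text \<open>
  \<open>Q x z = \<partial>h(x, u1)/\<partial>x f(x, z, u)\<close>, where \<open>\<partial>/\<partial>x\<close> acts on \<open>x \<mapsto> h(x, u1(x))\<close>.
\<close>

definition Q_map ::
  "('a \<Rightarrow> 'b \<Rightarrow> real \<Rightarrow> 'a) \<Rightarrow> ('a::real_normed_vector \<Rightarrow> real \<Rightarrow> 'b::real_normed_vector) \<Rightarrow>
   ('a \<Rightarrow> real) \<Rightarrow> ('a \<Rightarrow> 'b \<Rightarrow> real) \<Rightarrow> 'a \<Rightarrow> 'b \<Rightarrow> 'b" where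
  "Q_map f h u1 u x z = frechet_derivative (\<lambda>\<xi>. h \<xi> (u1 \<xi>)) (at x) (f x z (u x z))"

end

theory Submission
  imports Defs
begin

text \<open>
  Averaging \<open>\<Theta>\<^sup>T \<Theta>\<close> over a long time interval turns the two given contraction metrics into
  autonomous ones, \<open>P(x)\<close> for the reduced system and \<open>N(x, z)\<close> for the fast system: the time
  derivative contributes only boundary terms, which the lower bound on the metric dominates.
  With \<open>\<zeta> = dz - h' dx\<close>, the closed loop under \<open>u = u\<^sub>1 + u\<^sub>2\<close> contracts in the metric
  \<open>exp V (dx\<^sup>T P dx + K \<mu> \<zeta>\<^sup>T N \<zeta>)\<close>, \<open>V = g\<^sup>T N g\<close>. Its derivative along the flow has the form
  \<open>exp V (\<Phi>\<^sub>2/\<mu> + \<Phi>\<^sub>0 + \<mu> \<Phi>\<^sub>1)\<close>, where \<open>\<Phi>\<^sub>2 \<le> 0\<close> and, for large \<open>K\<close>, \<open>\<Phi>\<^sub>0 < 0\<close> wherever \<open>\<Phi>\<^sub>2 = 0\<close>; by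
  compactness it is negative for small \<open>\<mu>\<close>. A symmetric \<open>\<Theta>\<close> is obtained as an approximate
  square root, since strict inequalities survive a \<open>C\<^sup>1\<close>-small perturbation.
\<close>

section \<open>Calculus of \<open>C\<^sup>1\<close> maps\<close>

text \<open>Two obstacles shape the construction. The given metrics depend on a time that ranges
  over an unbounded interval, and they carry no upper bound, so compactness cannot be applied to
  them directly; it can be applied to autonomous fields. Moreover, the reduced system is known to
  contract only on the slow manifold g = 0. Away from it the block dx may expand at a rate of order
  1 even when \<zeta> = 0, and no constant weight between the two blocks repairs this. The factor
  exp V multiplies the slow block as well, and its logarithmic rate has order 1/\<mu>, negative
  wherever g \<noteq> 0. The variable \<zeta> vanishes on tangent vectors of the manifold, which dg
  annihilates, so on the manifold the fast equation acts on \<zeta> alone. The weight K \<mu> turns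
  the 1/\<mu> decay of \<zeta> into a term of order 1, comparable with the slow block, and pushes
  the slow drift of N and of h' to order \<mu>. The root identities hold on Bx only, yet their
  derivatives are needed at boundary points too; they come as limits from the interior. The
  approximate root is a polynomial in the metric, so its differentiability is immediate.\<close>

abbreviation fderiv ::
  "('a::real_normed_vector \<Rightarrow> 'b::real_normed_vector) \<Rightarrow> 'a \<Rightarrow> 'a \<Rightarrow> 'b" where
  "fderiv f x \<equiv> frechet_derivative f (at x)"

lemma fderiv_eq: "(f has_derivative f') (at x) \<Longrightarrow> fderiv f x = f'"
  using frechet_derivative_at by metis

lemma C1_onI:
  assumes "open U" "S \<subseteq> U"
    and "\<And>x. x \<in> U \<Longrightarrow> (f has_derivative f' x) (at x)"
    and "\<And>v. continuous_on U (\<lambda>x. f' x v)"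
  shows "C1_on f S"
proof -
  have "fderiv f x = f' x" if "x \<in> U" for x
    using assms(3) that by (simp add: fderiv_eq)
  then have "continuous_on U (\<lambda>x. fderiv f x v)" for v
    using assms(4)[of v] by (simp cong: continuous_on_cong)
  moreover have "f differentiable_on U"
    using assms(1,3) by (meson differentiableI differentiable_at_imp_differentiable_on)
  ultimately show ?thesis
    unfolding C1_on_def using assms(1,2) by auto
qed

lemma C1_onE:
  assumes "C1_on f S"
  obtains U where "open U" "S \<subseteq> U"
    and "\<And>x. x \<in> U \<Longrightarrow> (f has_derivative fderiv f x) (at x)"
    and "\<And>v. continuous_on U (\<lambda>x. fderiv f x v)"
proof -
  obtain U where U: "open U" "S \<subseteq> U" "f differentiable_on U" "\<And>v. continuous_on U (\<lambda>x. fderiv f x v)"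
    using assms unfolding C1_on_def by auto
  have "(f has_derivative fderiv f x) (at x)" if "x \<in> U" for x
    using U(1,3) that
    by (meson differentiable_on_eq_differentiable_at frechet_derivative_works)
  then show ?thesis
    using that U by blast
qed

lemma C1_on_has_derivative: "C1_on f S \<Longrightarrow> x \<in> S \<Longrightarrow> (f has_derivative fderiv f x) (at x)"
  by (metis C1_onE subsetD)

lemma C1_on_linear: "C1_on f S \<Longrightarrow> x \<in> S \<Longrightarrow> linear (fderiv f x)"
  by (meson C1_on_has_derivative has_derivative_linear)

lemma C1_on_subset: "C1_on f S \<Longrightarrow> T \<subseteq> S \<Longrightarrow> C1_on f T"
  unfolding C1_on_def by blast

lemma C1_on_imp_continuous_on: "C1_on f S \<Longrightarrow> continuous_on S f"
  by (meson C1_on_has_derivative continuous_at_imp_continuous_on has_derivative_continuous)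

lemma C1_on_cong_open:
  assumes "C1_on f S" "open W" "S \<subseteq> W" "\<And>x. x \<in> W \<Longrightarrow> f x = g x"
  shows "C1_on g S"
proof -
  obtain U where U: "open U" "S \<subseteq> U" "\<And>x. x \<in> U \<Longrightarrow> (f has_derivative fderiv f x) (at x)"
    "\<And>v. continuous_on U (\<lambda>x. fderiv f x v)"
    using C1_onE[OF assms(1)] by metis
  show ?thesis
  proof (rule C1_onI[of "U \<inter> W" _ _ "fderiv f"])
    show "(g has_derivative fderiv f x) (at x)" if "x \<in> U \<inter> W" for x
      using has_derivative_transform_within_open[OF U(3) assms(2), of x g] assms(4) that by auto
    show "continuous_on (U \<inter> W) (\<lambda>x. fderiv f x v)" for v
      using U(4) continuous_on_subset by blast
  qed (use U assms in auto)
qed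

lemma linear_basis_expansion:
  fixes L :: "'a::euclidean_space \<Rightarrow> 'b::real_vector"
  assumes "linear L"
  shows "L v = (\<Sum>i\<in>Basis. (v \<bullet> i) *\<^sub>R L i)"
proof -
  have "L v = L (\<Sum>i\<in>Basis. (v \<bullet> i) *\<^sub>R i)"
    by (simp add: euclidean_representation)
  also have "\<dots> = (\<Sum>i\<in>Basis. (v \<bullet> i) *\<^sub>R L i)"
    by (simp add: linear_sum[OF assms] linear_cmul[OF assms])
  finally show ?thesis .
qed

text \<open>\<open>C1_on\<close> provides continuity only for each fixed direction. Expanding the
  direction in a finite basis upgrades this to joint continuity in base point and direction, which
  the compactness arguments over pairs of a point and a unit vector require.\<close>

lemma continuous_on_linear_family:
  fixes f' :: "'a::real_normed_vector \<Rightarrow> 'b::euclidean_space \<Rightarrow> 'c::real_normed_vector"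
  assumes lin: "\<And>x. x \<in> U \<Longrightarrow> linear (f' x)" and c: "\<And>v. continuous_on U (\<lambda>x. f' x v)"
    and s: "continuous_on X s" "s ` X \<subseteq> U" and v: "continuous_on X v"
  shows "continuous_on X (\<lambda>y. f' (s y) (v y))"
proof -
  have "continuous_on X (\<lambda>y. \<Sum>i\<in>Basis. (v y \<bullet> i) *\<^sub>R f' (s y) i)"
    by (intro continuous_intros v continuous_on_compose2[OF c s])
  moreover have "f' (s y) (v y) = (\<Sum>i\<in>Basis. (v y \<bullet> i) *\<^sub>R f' (s y) i)" if "y \<in> X" for y
    using linear_basis_expansion[OF lin] s(2) that by blast
  ultimately show ?thesis
    by (simp cong: continuous_on_cong)
qed

lemma continuous_on_fderiv:
  fixes f :: "'a::euclidean_space \<Rightarrow> 'b::real_normed_vector"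
  assumes "C1_on f S" and "continuous_on X s" "\<And>y. y \<in> X \<Longrightarrow> s y \<in> S" and "continuous_on X v"
  shows "continuous_on X (\<lambda>y. fderiv f (s y) (v y))"
proof -
  obtain U where U: "S \<subseteq> U" "\<And>x. x \<in> U \<Longrightarrow> (f has_derivative fderiv f x) (at x)"
    "\<And>v. continuous_on U (\<lambda>x. fderiv f x v)"
    using C1_onE[OF assms(1)] by metis
  show ?thesis
    by (rule continuous_on_linear_family[of U "fderiv f"])
      (use U assms in \<open>auto intro: has_derivative_linear\<close>)
qed

section \<open>Closure properties of \<open>C1_on\<close>\<close>

lemma C1_on_bounded_linear_comp:
  assumes L: "bounded_linear L" and f: "C1_on f S"
  shows "C1_on (\<lambda>x. L (f x)) S"
proof -
  obtain U where U: "open U" "S \<subseteq> U" "\<And>x. x \<in> U \<Longrightarrow> (f has_derivative fderiv f x) (at x)"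
    "\<And>v. continuous_on U (\<lambda>x. fderiv f x v)"
    using C1_onE[OF f] by metis
  show ?thesis
    by (rule C1_onI[OF U(1,2), of _ "\<lambda>x v. L (fderiv f x v)"])
      (auto intro!: bounded_linear.has_derivative[OF L] bounded_linear.continuous_on[OF L] U)
qed

lemma C1_on_bounded_linear: "bounded_linear L \<Longrightarrow> C1_on L S"
  by (rule C1_onI[of UNIV _ _ "\<lambda>x. L"]) (auto intro: bounded_linear_imp_has_derivative)

lemma C1_on_const: "C1_on (\<lambda>x. c) S"
  by (rule C1_onI[of UNIV _ _ "\<lambda>x v. 0"]) auto

lemma C1_on_ident: "C1_on (\<lambda>x. x) S"
  by (rule C1_on_bounded_linear[OF bounded_linear_ident])

lemma C1_on_fst: "C1_on fst S" and C1_on_snd: "C1_on snd S"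
  by (auto intro!: C1_on_bounded_linear bounded_linear_fst bounded_linear_snd)

lemma C1_on_bilinear:
  assumes B: "bounded_bilinear B" and f: "C1_on f S" and g: "C1_on g S"
  shows "C1_on (\<lambda>x. B (f x) (g x)) S"
proof -
  obtain U where U: "open U" "S \<subseteq> U" "\<And>x. x \<in> U \<Longrightarrow> (f has_derivative fderiv f x) (at x)"
    "\<And>v. continuous_on U (\<lambda>x. fderiv f x v)"
    using C1_onE[OF f] by metis
  obtain V where V: "open V" "S \<subseteq> V" "\<And>x. x \<in> V \<Longrightarrow> (g has_derivative fderiv g x) (at x)"
    "\<And>v. continuous_on V (\<lambda>x. fderiv g x v)"
    using C1_onE[OF g] by metis
  have c: "continuous_on (U \<inter> V) f" "continuous_on (U \<inter> V) g"
    using U(3) V(3) by (meson IntE continuous_at_imp_continuous_on has_derivative_continuous)+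
  show ?thesis
  proof (rule C1_onI[of "U \<inter> V" _ _ "\<lambda>x v. B (f x) (fderiv g x v) + B (fderiv f x v) (g x)"])
    show "((\<lambda>x. B (f x) (g x)) has_derivative
        (\<lambda>v. B (f x) (fderiv g x v) + B (fderiv f x v) (g x))) (at x)" if "x \<in> U \<inter> V" for x
      using that by (intro bounded_bilinear.FDERIV[OF B] U V) auto
    show "continuous_on (U \<inter> V) (\<lambda>x. B (f x) (fderiv g x v) + B (fderiv f x v) (g x))" for v
      by (intro continuous_on_add bounded_bilinear.continuous_on[OF B] c
          continuous_on_subset[OF U(4)] continuous_on_subset[OF V(4)]) auto
  qed (use U V in auto)
qed

lemma C1_on_Pair:
  assumes f: "C1_on f S" and g: "C1_on g S"
  shows "C1_on (\<lambda>x. (f x, g x)) S"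
proof -
  obtain U where U: "open U" "S \<subseteq> U" "\<And>x. x \<in> U \<Longrightarrow> (f has_derivative fderiv f x) (at x)"
    "\<And>v. continuous_on U (\<lambda>x. fderiv f x v)"
    using C1_onE[OF f] by metis
  obtain V where V: "open V" "S \<subseteq> V" "\<And>x. x \<in> V \<Longrightarrow> (g has_derivative fderiv g x) (at x)"
    "\<And>v. continuous_on V (\<lambda>x. fderiv g x v)"
    using C1_onE[OF g] by metis
  show ?thesis
    by (rule C1_onI[of "U \<inter> V" _ _ "\<lambda>x v. (fderiv f x v, fderiv g x v)"])
      (use U V in \<open>auto intro!: has_derivative_Pair continuous_on_Pair
        continuous_on_subset[OF U(4)] continuous_on_subset[OF V(4)]\<close>)
qed

lemma C1_on_add:
  assumes "C1_on f S" "C1_on g S"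
  shows "C1_on (\<lambda>x. f x + g x) S"
  using C1_on_bounded_linear_comp[OF _ C1_on_Pair[OF assms], of "\<lambda>p. fst p + snd p"]
  by (simp add: bounded_linear_add bounded_linear_fst bounded_linear_snd)

lemma C1_on_sum: "(\<And>i. i \<in> I \<Longrightarrow> C1_on (f i) S) \<Longrightarrow> C1_on (\<lambda>x. \<Sum>i\<in>I. f i x) S"
  by (induction I rule: infinite_finite_induct) (auto intro: C1_on_const C1_on_add)

lemma C1_on_compose:
  fixes f :: "'a::real_normed_vector \<Rightarrow> 'b::euclidean_space"
    and g :: "'b \<Rightarrow> 'c::real_normed_vector"
  assumes g: "C1_on g T" and f: "C1_on f S" and fS: "\<And>x. x \<in> S \<Longrightarrow> f x \<in> T"
  shows "C1_on (\<lambda>x. g (f x)) S"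
proof -
  obtain U where U: "open U" "S \<subseteq> U" "\<And>x. x \<in> U \<Longrightarrow> (f has_derivative fderiv f x) (at x)"
    "\<And>v. continuous_on U (\<lambda>x. fderiv f x v)"
    using C1_onE[OF f] by metis
  obtain V where V: "open V" "T \<subseteq> V" "\<And>x. x \<in> V \<Longrightarrow> (g has_derivative fderiv g x) (at x)"
    "\<And>v. continuous_on V (\<lambda>x. fderiv g x v)"
    using C1_onE[OF g] by metis
  have c: "continuous_on U f"
    using U(3) by (meson continuous_at_imp_continuous_on has_derivative_continuous)
  let ?W = "U \<inter> f -` V"
  have "open ?W"
    using c U(1) V(1) by (metis continuous_on_open_vimage inf_commute)
  moreover have "((\<lambda>x. g (f x)) has_derivative (\<lambda>v. fderiv g (f x) (fderiv f x v))) (at x)"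
    if "x \<in> ?W" for x
    using that by (intro has_derivative_compose[OF U(3) V(3)]) auto
  moreover have "continuous_on ?W (\<lambda>x. fderiv g (f x) (fderiv f x v))" for v
    by (rule continuous_on_linear_family[of V "fderiv g"])
      (use U V c in \<open>auto intro: has_derivative_linear[OF V(3)] continuous_on_subset\<close>)
  moreover have "S \<subseteq> ?W"
    using U(2) V(2) fS by blast
  ultimately show ?thesis
    by (intro C1_onI[of ?W])
qed

lemma C1_on_exp:
  fixes f :: "'a::real_normed_vector \<Rightarrow> real"
  assumes "C1_on f S"
  shows "C1_on (\<lambda>x. exp (f x)) S"
proof (rule C1_on_compose[OF _ assms, of _ UNIV])
  have "(exp has_derivative (\<lambda>v. exp x * v)) (at x)" for x :: real
    using DERIV_exp has_field_derivative_def by blast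
  then show "C1_on exp (UNIV :: real set)"
    by (intro C1_onI[of UNIV]) (auto intro!: continuous_intros)
qed auto

section \<open>Smooth maps\<close>

lemma smooth_on_imp_C1_on: "smooth_on f S \<Longrightarrow> C1_on f S"
  unfolding smooth_on_def C1_on_def by blast

lemma Blinfun_eq_sum:
  fixes L :: "'a::euclidean_space \<Rightarrow> 'b::real_normed_vector"
  assumes "linear L"
  shows "Blinfun L = (\<Sum>i\<in>Basis. blinfun_scaleR_left (L i) o\<^sub>L blinfun_inner_left i)"
  by (rule blinfun_eqI)
    (simp add: bounded_linear_Blinfun_apply linear_conv_bounded_linear[THEN iffD1, OF assms]
      blinfun.sum_left linear_basis_expansion[OF assms, symmetric])

text \<open>Smoothness speaks of one direction at a time; in finite dimension the operator-valued
  derivative is a finite sum over basis directions and inherits the regularity. This is where second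
  derivatives become available: the combined metric contains the derivative of the root map and must
  itself be differentiated.\<close>

lemma smooth_on_fderiv_C1:
  fixes f :: "'a::euclidean_space \<Rightarrow> 'b::real_normed_vector"
  assumes "smooth_on f S"
  shows "C1_on (\<lambda>x. Blinfun (fderiv f x)) S"
proof -
  obtain U where U: "open U" "S \<subseteq> U" "\<And>k. Ck_on_open k f U"
    using assms unfolding smooth_on_def by blast
  have lin: "linear (fderiv f x)" if "x \<in> U" for x
    using U(3)[of 1] U(1) that
    by (auto intro!: linear_frechet_derivative simp: differentiable_on_eq_differentiable_at)
  have "Ck_on_open 1 (\<lambda>x. fderiv f x v) U" for v
    using U(3)[of "Suc 1"] unfolding Ck_on_open.simps(2)[of 1] by blast
  then have "C1_on (\<lambda>x. fderiv f x v) S" for v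
    unfolding C1_on_def using U(1,2) by blast
  then have "C1_on (\<lambda>x. \<Sum>i\<in>Basis. blinfun_scaleR_left (fderiv f x i) o\<^sub>L blinfun_inner_left i) S"
    by (intro C1_on_sum C1_on_bilinear[OF bounded_bilinear_blinfun_compose] C1_on_const
        C1_on_bounded_linear_comp[OF bounded_linear_blinfun_scaleR_left])
  then show ?thesis
    by (rule C1_on_cong_open[OF _ U(1,2)]) (simp add: Blinfun_eq_sum[OF lin])
qed

text \<open>The recursion in \<open>Ck_on_open\<close> passes to the function
  \<open>fderiv f\<close>, which is known by a formula only on \<open>U\<close>. Exchanging it for
  that formula is what makes the inductions for sums and for the first projection work; these serve
  to show that the feedback \<open>u1 + u2\<close> is smooth.\<close>

lemma Ck_on_open_cong:
  assumes "open U" "\<And>x. x \<in> U \<Longrightarrow> f x = g x"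
  shows "Ck_on_open k f U \<longleftrightarrow> Ck_on_open k g U"
proof -
  have "Ck_on_open k g U" if "\<And>x. x \<in> U \<Longrightarrow> f x = g x" "Ck_on_open k f U" for k f g
    using that
  proof (induction k arbitrary: f g)
    case 0
    then show ?case by (metis Ck_on_open.simps(1) continuous_on_cong)
  next
    case (Suc k)
    have d: "f differentiable at x" if "x \<in> U" for x
      using Suc.prems(2) assms(1) that by (auto simp: differentiable_on_eq_differentiable_at)
    have "fderiv f x = fderiv g x" if "x \<in> U" for x
      using frechet_derivative_transform_within_open[OF d assms(1)] that Suc.prems(1) by blast
    then have "Ck_on_open k (\<lambda>x. fderiv g x v) U" for v
      using Suc.IH[of "\<lambda>x. fderiv f x v"] Suc.prems(2) by simp
    moreover have "g differentiable_on U"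
      using Suc.prems by (auto simp: differentiable_on_def intro: differentiable_transform_within[OF _ zero_less_one])
    ultimately show ?case by simp
  qed
  then show ?thesis
    using assms(2) by metis
qed

lemma Ck_on_open_add:
  assumes "open U" "Ck_on_open k f U" "Ck_on_open k g U"
  shows "Ck_on_open k (\<lambda>x. f x + g x) U"
  using assms(2,3)
proof (induction k arbitrary: f g)
  case 0
  then show ?case by (auto intro: continuous_on_add)
next
  case (Suc k)
  have "f differentiable at x" "g differentiable at x" if "x \<in> U" for x
    using Suc.prems assms(1) that by (auto simp: differentiable_on_eq_differentiable_at)
  then have "fderiv (\<lambda>x. f x + g x) x = (\<lambda>v. fderiv f x v + fderiv g x v)" if "x \<in> U" for x
    using that by (intro fderiv_eq has_derivative_add) (auto simp: frechet_derivative_works)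
  then have eq: "fderiv f x v + fderiv g x v = fderiv (\<lambda>x. f x + g x) x v" if "x \<in> U" for x v
    using that by simp
  have "Ck_on_open k (\<lambda>x. fderiv f x v + fderiv g x v) U" for v
    using Suc.prems by (intro Suc.IH) simp_all
  then have "Ck_on_open k (\<lambda>x. fderiv (\<lambda>x. f x + g x) x v) U" for v
    using Ck_on_open_cong[OF assms(1), of "\<lambda>x. fderiv f x v + fderiv g x v"
        "\<lambda>x. fderiv (\<lambda>x. f x + g x) x v" k, OF eq] by blast
  then show ?case
    using Suc.prems by (auto intro: differentiable_on_add)
qed

lemma Ck_on_open_fst:
  fixes U :: "'a::real_normed_vector set" and f :: "'a \<Rightarrow> 'b::real_normed_vector"
  assumes "open U" "Ck_on_open k f U"
  shows "Ck_on_open k (\<lambda>p :: 'a \<times> 'c::real_normed_vector. f (fst p)) (U \<times> UNIV)"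
  using assms(2)
proof (induction k arbitrary: f)
  case 0
  then show ?case 
    by (auto intro!: continuous_on_compose2[of U f] continuous_on_fst continuous_on_id)
next
  case (Suc k)
  have O: "open (U \<times> (UNIV :: 'c set))"
    using assms(1) by (simp add: open_Times)
  have "f differentiable at x" if "x \<in> U" for x
    using Suc.prems assms(1) that by (auto simp: differentiable_on_eq_differentiable_at)
  then have d: "((\<lambda>p. f (fst p)) has_derivative (\<lambda>v. fderiv f (fst p) (fst v))) (at p)"
    if "p \<in> U \<times> UNIV" for p :: "'a \<times> 'c"
    using that
    by (intro has_derivative_compose[OF bounded_linear_imp_has_derivative[OF bounded_linear_fst]])
      (auto simp: frechet_derivative_works)
  then have eq: "fderiv f (fst p) (fst v) = fderiv (\<lambda>p. f (fst p)) p v"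
    if "p \<in> U \<times> UNIV" for p v :: "'a \<times> 'c"
    using fderiv_eq[OF d[OF that]] by simp
  have "Ck_on_open k (\<lambda>p :: 'a \<times> 'c. fderiv f (fst p) (fst v)) (U \<times> UNIV)" for v :: "'a \<times> 'c"
    using Suc.prems by (intro Suc.IH) simp
  then have "Ck_on_open k (\<lambda>p. fderiv (\<lambda>p. f (fst p)) p v) (U \<times> UNIV)" for v :: "'a \<times> 'c"
    using Ck_on_open_cong[OF O, of "\<lambda>p. fderiv f (fst p) (fst v)"
        "\<lambda>p. fderiv (\<lambda>p. f (fst p)) p v" k, OF eq] by blast
  moreover have "(\<lambda>p :: 'a \<times> 'c. f (fst p)) differentiable_on U \<times> UNIV"
    using differentiableI[OF d] O by (simp add: differentiable_on_eq_differentiable_at)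
  ultimately show ?case
    by (simp del: split_paired_All)
qed

lemma Ck_on_open_subset: "Ck_on_open k f U \<Longrightarrow> V \<subseteq> U \<Longrightarrow> Ck_on_open k f V"
  by (induction k arbitrary: f) (auto intro: continuous_on_subset differentiable_on_subset)

lemma smooth_on_add:
  assumes "smooth_on f S" "smooth_on g S"
  shows "smooth_on (\<lambda>x. f x + g x) S"
proof -
  obtain U V where U: "open U" "S \<subseteq> U" "\<And>k. Ck_on_open k f U"
    and V: "open V" "S \<subseteq> V" "\<And>k. Ck_on_open k g V"
    using assms unfolding smooth_on_def by blast
  show ?thesis
    unfolding smooth_on_def
    by (rule exI[of _ "U \<inter> V"])
      (use U V Ck_on_open_subset[OF U(3)] Ck_on_open_subset[OF V(3)]
        in \<open>auto intro!: Ck_on_open_add\<close>)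
qed

lemma smooth_on_fst:
  assumes "smooth_on f S"
  shows "smooth_on (\<lambda>p. f (fst p)) (S \<times> T)"
proof -
  obtain U where U: "open U" "S \<subseteq> U" "\<And>k. Ck_on_open k f U"
    using assms unfolding smooth_on_def by blast
  show ?thesis
    unfolding smooth_on_def
    by (rule exI[of _ "U \<times> UNIV"]) (use U in \<open>auto intro!: Ck_on_open_fst open_Times\<close>)
qed

text \<open>At interior points the functions agree on a neighbourhood, and boundary points are
  reached as limits because both derivatives are continuous on \<open>S\<close>. Without the density
  of the interior, equality on \<open>S\<close> would say nothing about transversal
  derivatives.\<close>

lemma C1_on_fderiv_unique:
  fixes f g :: "'a::euclidean_space \<Rightarrow> 'b::real_normed_vector"
  assumes f: "C1_on f S" and g: "C1_on g S" and eq: "\<And>x. x \<in> S \<Longrightarrow> f x = g x"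
    and S: "closed S" "S \<subseteq> closure (interior S)" and x: "x \<in> S"
  shows "fderiv f x = fderiv g x"
proof
  fix v
  have cl: "closure (interior S) = S"
    using S by (metis closure_minimal interior_subset subset_antisym)
  have "fderiv f x v - fderiv g x v = 0"
  proof (rule continuous_constant_on_closure[of "interior S" "\<lambda>x. fderiv f x v - fderiv g x v"])
    show "continuous_on (closure (interior S)) (\<lambda>x. fderiv f x v - fderiv g x v)"
      unfolding cl
      by (intro continuous_on_diff continuous_on_fderiv[OF f] continuous_on_fderiv[OF g])
        (auto intro: continuous_intros)
    show "fderiv f y v - fderiv g y v = 0" if y: "y \<in> interior S" for y
    proof -
      have "f differentiable at y"
        using C1_on_has_derivative[OF f] y interior_subset by (metis differentiableI subsetD)
      then have "fderiv f y = fderiv g y"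
        using frechet_derivative_transform_within_open[of f y "interior S" g] y eq interior_subset
        by (metis open_interior subsetD)
      then show ?thesis by simp
    qed
    show "x \<in> closure (interior S)"
      using cl x by simp
  qed
  then show "fderiv f x v = fderiv g x v" by simp
qed

section \<open>Compactness\<close>

text \<open>A nonlinear form of Finsler's lemma: where \<phi> \<ge> 0, a compact set, \<gamma> is
  strictly negative and hence bounded away from 0, so a large multiple of it wins; elsewhere \<phi>
  is already negative and the penalty does not hurt.\<close>

lemma compact_penalty:
  fixes \<phi> \<gamma> :: "'a::t2_space \<Rightarrow> real"
  assumes X: "compact X" and \<phi>: "continuous_on X \<phi>" and \<gamma>: "continuous_on X \<gamma>"
    and nonpos: "\<And>x. x \<in> X \<Longrightarrow> \<gamma> x \<le> 0"
    and zero: "\<And>x. x \<in> X \<Longrightarrow> \<gamma> x = 0 \<Longrightarrow> \<phi> x < 0"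
  obtains \<beta> where "\<beta> > 0" "\<And>x k. x \<in> X \<Longrightarrow> k \<ge> \<beta> \<Longrightarrow> \<phi> x + k * \<gamma> x < 0"
proof -
  define Z where "Z = X \<inter> \<phi> -` {0..}"
  have Z: "compact Z"
    unfolding Z_def
    by (metis X \<phi> closed_atLeast compact_Int_closed compact_imp_closed continuous_closed_preimage
        inf.left_idem)
  show ?thesis
  proof (cases "Z = {}")
    case True
    then have "\<phi> x < 0" if "x \<in> X" for x
      using that unfolding Z_def by fastforce
    then show ?thesis
      using that[of 1] nonpos by (smt (verit) mult_nonneg_nonpos)
  next
    case False
    have "continuous_on Z \<phi>" "continuous_on Z \<gamma>"
      using \<phi> \<gamma> continuous_on_subset unfolding Z_def by blast+
    then obtain a b where a: "a \<in> Z" "\<And>x. x \<in> Z \<Longrightarrow> \<phi> x \<le> \<phi> a"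
      and b: "b \<in> Z" "\<And>x. x \<in> Z \<Longrightarrow> \<gamma> x \<le> \<gamma> b"
      using continuous_attains_sup[OF Z False] by metis
    have "\<gamma> b < 0"
      using b(1) nonpos zero unfolding Z_def by fastforce
    \<comment> \<open>Solves \<open>\<beta> * \<gamma> b = - (\<phi> a + 1)\<close>, with the worst
      values of \<phi> and \<gamma> on \<open>Z\<close>, so that the sum is at most -1
      there.\<close>
    define \<beta> where "\<beta> = (\<phi> a + 1) / - \<gamma> b"
    have "\<phi> a \<ge> 0"
      using a(1) by (simp add: Z_def)
    then have \<beta>: "\<beta> > 0"
      using \<open>\<gamma> b < 0\<close> unfolding \<beta>_def by (intro divide_pos_pos) auto
    have "\<phi> x + k * \<gamma> x < 0" if "x \<in> X" "k \<ge> \<beta>" for x k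
    proof (cases "x \<in> Z")
      case True
      have "k * \<gamma> x \<le> \<beta> * \<gamma> b"
      proof -
        have "k * \<gamma> x \<le> k * \<gamma> b"
          using b(2)[OF True] that(2) \<beta> by (intro mult_left_mono) auto
        also have "\<dots> \<le> \<beta> * \<gamma> b"
          using that(2) \<open>\<gamma> b < 0\<close> by (intro mult_right_mono_neg) auto
        finally show ?thesis .
      qed
      also have "\<beta> * \<gamma> b = - (\<phi> a + 1)"
        using \<open>\<gamma> b < 0\<close> by (simp add: \<beta>_def)
      finally show ?thesis
        using a(2)[OF True] by linarith
    next
      case False
      then have "\<phi> x < 0" using that(1) by (simp add: Z_def)
      moreover have "k * \<gamma> x \<le> 0"
        using nonpos[OF that(1)] that(2) \<beta> by (simp add: mult_nonneg_nonpos)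
      ultimately show ?thesis by linarith
    qed
    then show ?thesis using that \<beta> by blast
  qed
qed

lemma compact_negative_bound:
  fixes \<phi> :: "'a::t2_space \<Rightarrow> real"
  assumes "compact X" "continuous_on X \<phi>" "\<And>x. x \<in> X \<Longrightarrow> \<phi> x < 0"
  obtains \<rho> where "\<rho> > 0" "\<And>x. x \<in> X \<Longrightarrow> \<phi> x \<le> - \<rho>"
proof (cases "X = {}")
  case False
  then obtain a where "a \<in> X" "\<And>x. x \<in> X \<Longrightarrow> \<phi> x \<le> \<phi> a"
    using continuous_attains_sup assms(1,2) by metis
  then show ?thesis
    using that[of "- \<phi> a"] assms(3) by simp
qed (use that[of 1] in simp)

lemma compact_bound:
  fixes f :: "'a::t2_space \<Rightarrow> 'b::real_normed_vector"
  assumes "compact X" "continuous_on X f"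
  obtains B where "B > 0" "\<And>x. x \<in> X \<Longrightarrow> norm (f x) \<le> B"
proof -
  have "bounded (f ` X)"
    using assms by (simp add: compact_continuous_image compact_imp_bounded)
  then show ?thesis
    using that unfolding bounded_pos by auto
qed

text \<open>The penalty argument is used twice, with k = 1/\<mu>: first \<phi>2 makes \<phi>0 + a
  \<phi>2 negative, then this negative function dominates \<phi>1. In the second use the case where
  the penalty vanishes cannot occur. Replacing \<phi>2/\<mu> by a \<phi>2 is an upper estimate since
  \<phi>2 \<le> 0.\<close>

lemma three_term_negative:
  fixes \<phi>0 \<phi>1 \<phi>2 :: "'a::t2_space \<Rightarrow> real"
  assumes X: "compact X"
    and c: "continuous_on X \<phi>0" "continuous_on X \<phi>1" "continuous_on X \<phi>2"
    and nonpos: "\<And>x. x \<in> X \<Longrightarrow> \<phi>2 x \<le> 0"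
    and zero: "\<And>x. x \<in> X \<Longrightarrow> \<phi>2 x = 0 \<Longrightarrow> \<phi>0 x < 0"
  obtains \<mu>0 where "0 < \<mu>0" "\<mu>0 \<le> 1"
    "\<And>x \<mu>. x \<in> X \<Longrightarrow> 0 < \<mu> \<Longrightarrow> \<mu> \<le> \<mu>0 \<Longrightarrow> \<phi>2 x / \<mu> + \<phi>0 x + \<mu> * \<phi>1 x < 0"
proof -
  obtain a where a: "a > 0" "\<And>x k. x \<in> X \<Longrightarrow> k \<ge> a \<Longrightarrow> \<phi>0 x + k * \<phi>2 x < 0"
    using compact_penalty[OF X c(1,3) nonpos zero] by metis
  obtain b where b: "b > 0" "\<And>x k. x \<in> X \<Longrightarrow> k \<ge> b \<Longrightarrow> \<phi>1 x + k * (\<phi>0 x + a * \<phi>2 x) < 0"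
  proof (rule compact_penalty[OF X c(2), of "\<lambda>x. \<phi>0 x + a * \<phi>2 x"])
    show "continuous_on X (\<lambda>x. \<phi>0 x + a * \<phi>2 x)"
      by (intro continuous_intros c)
    show "\<phi>0 x + a * \<phi>2 x \<le> 0" if "x \<in> X" for x
      using a(2)[OF that, of a] by simp
    show "\<phi>1 x < 0" if "x \<in> X" "\<phi>0 x + a * \<phi>2 x = 0" for x
      using a(2)[OF that(1), of a] that(2) by simp
  qed blast
  define \<mu>0 where "\<mu>0 = 1 / max 1 (max a b)"
  have "\<phi>2 x / \<mu> + \<phi>0 x + \<mu> * \<phi>1 x < 0" if x: "x \<in> X" and \<mu>: "0 < \<mu>" "\<mu> \<le> \<mu>0" for x \<mu>
  proof -
    have "max 1 (max a b) \<le> 1 / \<mu>"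
      using le_imp_inverse_le[OF \<mu>(2,1)] by (simp add: \<mu>0_def inverse_eq_divide)
    then have le: "a \<le> 1 / \<mu>" "b \<le> 1 / \<mu>"
      by auto
    have "\<mu> * (\<phi>1 x + (1 / \<mu>) * (\<phi>0 x + a * \<phi>2 x)) < 0"
      using b(2)[OF x le(2)] \<mu>(1) by (rule mult_pos_neg[rotated])
    moreover have "\<mu> * (\<phi>1 x + (1 / \<mu>) * (\<phi>0 x + a * \<phi>2 x)) = \<mu> * \<phi>1 x + \<phi>0 x + a * \<phi>2 x"
      using \<mu>(1) by (simp add: distrib_left)
    moreover have "(1 / \<mu>) * \<phi>2 x \<le> a * \<phi>2 x"
      using le(1) nonpos[OF x] by (rule mult_right_mono_neg)
    ultimately show ?thesis by simp
  qed
  then show ?thesis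
    using that[of \<mu>0] by (auto simp: \<mu>0_def)
qed

section \<open>Adjoints\<close>

lift_definition blinfun_adjoint :: "('a::euclidean_space \<Rightarrow>\<^sub>L 'b::euclidean_space) \<Rightarrow> 'b \<Rightarrow>\<^sub>L 'a"
  is adjoint
  by (metis adjoint_linear linear_conv_bounded_linear)

lemma blinfun_adjoint_right: "x \<bullet> blinfun_adjoint A y = A x \<bullet> y"
  by transfer (simp add: adjoint_works bounded_linear.linear)

lemma blinfun_adjoint_left: "blinfun_adjoint A y \<bullet> x = y \<bullet> A x"
  by (metis blinfun_adjoint_right inner_commute)

lemma bounded_linear_blinfun_adjoint: "bounded_linear blinfun_adjoint"
proof (rule bounded_linear_intro[where K=1])
  fix A B :: "'a \<Rightarrow>\<^sub>L 'b" and r :: real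
  have eqI: "P = Q" if "\<And>x y. x \<bullet> P y = x \<bullet> Q y" for P Q :: "'b \<Rightarrow>\<^sub>L 'a"
    by (rule blinfun_eqI, rule vector_eq_ldot[THEN iffD1]) (use that in blast)
  show "blinfun_adjoint (A + B) = blinfun_adjoint A + blinfun_adjoint B"
    by (rule eqI) (simp only: blinfun_adjoint_right blinfun.add_left inner_add_left inner_add_right)
  show "blinfun_adjoint (r *\<^sub>R A) = r *\<^sub>R blinfun_adjoint A"
    by (rule eqI) (simp only: blinfun_adjoint_right blinfun.scaleR_left inner_scaleR_left inner_scaleR_right)
  show "norm (blinfun_adjoint A) \<le> norm A * 1"
  proof (rule norm_blinfun_bound)
    fix y
    define z where "z = blinfun_adjoint A y"
    have "(norm z)\<^sup>2 = A z \<bullet> y"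
      using blinfun_adjoint_right[of z A y] by (simp add: z_def power2_norm_eq_inner)
    also have "\<dots> \<le> norm (A z) * norm y"
      by (rule norm_cauchy_schwarz)
    also have "\<dots> \<le> norm A * norm z * norm y"
      by (intro mult_right_mono norm_blinfun norm_ge_zero)
    finally have "norm z * norm z \<le> norm z * (norm A * norm y)"
      by (simp add: power2_eq_square ac_simps)
    then have "norm z \<le> norm A * norm y"
      using mult_left_le_imp_le[of "norm z" "norm z" "norm A * norm y"] by (cases "z = 0") auto
    then show "norm (blinfun_adjoint A y) \<le> norm A * 1 * norm y"
      by (simp add: z_def)
  qed simp
qed

section \<open>Averaging a metric over time\<close>

lemma fderiv_gram:
  assumes "C1_on \<Theta> S" "q \<in> S"
  shows "fderiv (\<lambda>q. blinfun_adjoint (\<Theta> q) o\<^sub>L \<Theta> q) q v =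
    (blinfun_adjoint (\<Theta> q) o\<^sub>L fderiv \<Theta> q v) + (blinfun_adjoint (fderiv \<Theta> q v) o\<^sub>L \<Theta> q)"
proof -
  note d = C1_on_has_derivative[OF assms]
  show ?thesis
    by (subst fderiv_eq[OF bounded_bilinear.FDERIV[OF bounded_bilinear_blinfun_compose
            bounded_linear.has_derivative[OF bounded_linear_blinfun_adjoint d] d]]) simp
qed

lemma blinfun_adjoint_eqI:
  assumes "\<And>v w. blinfun_apply A v \<bullet> w = v \<bullet> blinfun_apply A w"
  shows "blinfun_adjoint A = A"
  by (rule blinfun_eqI, rule vector_eq_ldot[THEN iffD1]) (simp add: blinfun_adjoint_right assms)

lemma C1_on_integral:
  fixes M :: "'p::euclidean_space \<times> real \<Rightarrow> 'c::banach"
  assumes M: "C1_on M (S \<times> {a..b})"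
  shows "C1_on (\<lambda>p. integral {a..b} (\<lambda>t. M (p, t))) S"
    and "\<And>p v. p \<in> S \<Longrightarrow> fderiv (\<lambda>p. integral {a..b} (\<lambda>t. M (p, t))) p v =
           integral {a..b} (\<lambda>t. fderiv M (p, t) (v, 0))"
proof -
  let ?K = "cbox a b"
  let ?N = "\<lambda>p. integral ?K (\<lambda>t. M (p, t))"
  let ?N' = "\<lambda>p v. integral ?K (\<lambda>t. fderiv M (p, t) (v, 0))"
  obtain U where U: "open U" "S \<times> ?K \<subseteq> U" "\<And>q. q \<in> U \<Longrightarrow> (M has_derivative fderiv M q) (at q)"
    "\<And>v. continuous_on U (\<lambda>q. fderiv M q v)"
    using C1_onE[OF M] by (metis interval_cbox)
  \<comment> \<open>Differentiating at \<open>p\<close> needs a neighbourhood of \<open>p\<close> on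
    which the whole time interval stays inside \<open>U\<close>; since the interval is compact, the
    tube lemma shows that these points form an open set.\<close>
  define U0 where "U0 = {p. {p} \<times> ?K \<subseteq> U}"
  have "open U0"
    unfolding open_subopen[of U0]
  proof
    fix p assume "p \<in> U0"
    then have "{p} \<times> ?K \<subseteq> U"
      by (simp add: U0_def)
    from Elementary_Topology.tube_lemma[OF compact_cbox U(1) this]
    obtain X0 where X0: "p \<in> X0" "open X0" "X0 \<times> ?K \<subseteq> U"
      by metis
    have "X0 \<subseteq> U0"
      using X0(3) by (auto simp: U0_def)
    then show "\<exists>T. open T \<and> p \<in> T \<and> T \<subseteq> U0"
      using X0(1,2) by metis
  qed
  have "S \<subseteq> U0"
    using U(2) unfolding U0_def by blast
  have inU: "(p, t) \<in> U" if "p \<in> U0" "t \<in> ?K" for p t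
    using that unfolding U0_def by blast
  have lin: "linear (fderiv M q)" if "q \<in> U" for q
    using U(3)[OF that] has_derivative_linear by blast
  have contM: "continuous_on U M"
    using U(3) by (meson continuous_at_imp_continuous_on has_derivative_continuous)
  \<comment> \<open>The Leibniz rule asks for a jointly continuous operator-valued derivative in
    \<open>p\<close>; it is the spatial part of the derivative of \<open>M\<close>.\<close>
  define G where "G p t = Blinfun (\<lambda>v. fderiv M (p, t) (v, 0))" for p t
  have bl: "bounded_linear (\<lambda>v. fderiv M (p, t) (v, 0))" if "p \<in> U0" "t \<in> ?K" for p t
    by (rule bounded_linear_compose[OF has_derivative_bounded_linear[OF U(3)[OF inU[OF that]]]])
      (intro bounded_linear_Pair bounded_linear_ident bounded_linear_zero)
  have G: "G p t v = fderiv M (p, t) (v, 0)" if "p \<in> U0" "t \<in> ?K" for p t v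
    unfolding G_def by (simp add: bounded_linear_Blinfun_apply[OF bl[OF that]])
  have contG: "continuous_on (U0 \<times> ?K) (\<lambda>(p, t). G p t)"
  proof (rule continuous_on_blinfun_componentwise)
    fix i :: 'p
    have "continuous_on (U0 \<times> ?K) (\<lambda>q. fderiv M q (i, 0))"
      by (rule continuous_on_subset[OF U(4)]) (use inU in auto)
    then show "continuous_on (U0 \<times> ?K) (\<lambda>x. blinfun_apply (case x of (p, t) \<Rightarrow> G p t) i)"
      using G by (subst continuous_on_cong[OF refl, of _ _ "\<lambda>q. fderiv M q (i, 0)"]) auto
  qed
  have intM: "(\<lambda>t. M (p, t)) integrable_on ?K" if "p \<in> U0" for p
    by (rule integrable_continuous, rule continuous_on_compose2[OF contM])
      (use inU that in \<open>auto intro!: continuous_intros\<close>)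
  have der: "(?N has_derivative ?N' p) (at p)" if p: "p \<in> U0" for p
  proof -
    obtain e where e: "e > 0" "ball p e \<subseteq> U0"
      using \<open>open U0\<close> p open_contains_ball by blast
    have "((\<lambda>p. integral ?K (\<lambda>t. M (p, t))) has_derivative integral ?K (G p)) (at p within ball p e)"
    proof (rule leibniz_rule)
      fix y t assume yt: "y \<in> ball p e" "t \<in> ?K"
      then have y: "y \<in> U0" using e by blast
      have "blinfun_apply (G y t) = (\<lambda>v. fderiv M (y, t) (v, 0))"
        using G[OF y yt(2)] by blast
      moreover have "((\<lambda>x. M (x, t)) has_derivative (\<lambda>v. fderiv M (y, t) (v, 0))) (at y)"
        by (rule has_derivative_compose[of "\<lambda>x. (x, t)" "\<lambda>v. (v, 0)" y UNIV M "fderiv M (y, t)"])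
          (auto intro!: derivative_eq_intros U(3) inU y yt(2))
      ultimately show "((\<lambda>x. M (x, t)) has_derivative blinfun_apply (G y t)) (at y within ball p e)"
        using has_derivative_at_withinI by metis
    next
      show "(\<lambda>t. M (y, t)) integrable_on ?K" if "y \<in> ball p e" for y
        using intM that e by blast
      show "continuous_on (ball p e \<times> ?K) (\<lambda>(p, t). G p t)"
        by (rule continuous_on_subset[OF contG]) (use e in auto)
    qed (use e in auto)
    then have "(?N has_derivative integral ?K (G p)) (at p)"
      using e(1) by (simp add: at_within_open[of p "ball p e"])
    moreover have "blinfun_apply (integral ?K (G p)) v = ?N' p v" for v
    proof -
      have "G p integrable_on ?K"
        by (rule integrable_continuous, rule continuous_on_compose2[OF contG, of _ "\<lambda>t. (p, t)", simplified])
          (use p in \<open>auto intro!: continuous_intros\<close>)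
      then have "blinfun_apply (integral ?K (G p)) v = integral ?K (\<lambda>t. G p t v)"
        using integral_linear[of "G p" ?K "\<lambda>A. blinfun_apply A v"] by (simp add: o_def)
      also have "\<dots> = ?N' p v"
        by (rule integral_cong) (use G p in auto)
      finally show ?thesis .
    qed
    ultimately show ?thesis
      by (metis (no_types, lifting) ext)
  qed
  have cN': "continuous_on U0 (\<lambda>p. ?N' p v)" for v
    by (rule integral_continuous_on_param)
      (use inU in \<open>auto intro!: continuous_on_subset[OF U(4)] simp: case_prod_beta\<close>)
  show "C1_on (\<lambda>p. integral {a..b} (\<lambda>t. M (p, t))) S"
    using C1_onI[OF \<open>open U0\<close> \<open>S \<subseteq> U0\<close> der cN'] by simp
  show "fderiv (\<lambda>p. integral {a..b} (\<lambda>t. M (p, t))) p v = integral {a..b} (\<lambda>t. fderiv M (p, t) (v, 0))"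
    if "p \<in> S" for p v
    using fun_cong[OF fderiv_eq[OF der[OF subsetD[OF \<open>S \<subseteq> U0\<close> that]]], of v] by simp
qed

text \<open>For \<open>M = \<Theta>\<^sup>T \<Theta>\<close> the hypothesis reads: derivative of
  \<open>M\<close> along (X, 1) plus twice the symmetric part of M J is at most -2 l M. Integrated
  over time, the time derivative of \<open>M\<close> leaves only end values, while the decay grows
  linearly in the length of the interval. \<open>X\<close> and \<open>J\<close> are kept separate so
  that the moving variables may be part of the state only: for the fast system \<open>X p\<close> is
  (0, g p) and \<open>J p\<close> acts on the z-block.\<close>

lemma time_average_metric:
  fixes \<Theta> :: "'p::euclidean_space \<times> real \<Rightarrow> 'a::euclidean_space \<Rightarrow>\<^sub>L 'a"
  assumes m: "metric_on \<Theta> (S \<times> {0<..})" and S: "compact S" and l: "l > 0"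
    and contr: "\<And>p t w. p \<in> S \<Longrightarrow> t > 0 \<Longrightarrow>
      \<Theta> (p, t) w \<bullet> (fderiv \<Theta> (p, t) (X p, 1) w + \<Theta> (p, t) (J p w))
        \<le> - l * (\<Theta> (p, t) w \<bullet> \<Theta> (p, t) w)"
  obtains N :: "'p \<Rightarrow> 'a \<Rightarrow>\<^sub>L 'a" where "C1_on N S" "\<And>p. blinfun_adjoint (N p) = N p"
    "\<And>p w. p \<in> S \<Longrightarrow> w \<noteq> 0 \<Longrightarrow> w \<bullet> N p w > 0"
    "\<And>p w. p \<in> S \<Longrightarrow> w \<noteq> 0 \<Longrightarrow> w \<bullet> fderiv N p (X p) w + 2 * (w \<bullet> N p (J p w)) < 0"
proof -
  have \<Theta>: "C1_on \<Theta> (S \<times> {0<..})"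
    using m unfolding metric_on_def by blast
  obtain \<epsilon> where \<epsilon>: "\<epsilon> > 0" "\<And>q v. q \<in> S \<times> {0<..} \<Longrightarrow> \<epsilon> * (v \<bullet> v) \<le> \<Theta> q v \<bullet> \<Theta> q v"
    using m unfolding metric_on_def by blast
  define M where "M q = blinfun_adjoint (\<Theta> q) o\<^sub>L \<Theta> q" for q
  have M: "C1_on M (S \<times> {0<..})"
    unfolding M_def
    by (intro C1_on_bilinear[OF bounded_bilinear_blinfun_compose] \<Theta>
        C1_on_bounded_linear_comp[OF bounded_linear_blinfun_adjoint])
  have Mw: "v \<bullet> M q w = \<Theta> q v \<bullet> \<Theta> q w" for q v w
    by (simp add: M_def blinfun_adjoint_right)
  have dM: "w \<bullet> fderiv M q Y w = 2 * (\<Theta> q w \<bullet> fderiv \<Theta> q Y w)" if "q \<in> S \<times> {0<..}" for q Y w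
    unfolding M_def fderiv_gram[OF \<Theta> that]
    by (simp add: blinfun.bilinear_simps inner_simps blinfun_adjoint_right inner_commute)
  have "continuous_on S (\<lambda>p. M (p, 1))"
    by (rule continuous_on_compose2[OF C1_on_imp_continuous_on[OF M]]) (auto intro!: continuous_intros)
  then obtain B where B: "B > 0" "\<And>p. p \<in> S \<Longrightarrow> norm (M (p, 1)) \<le> B"
    using compact_bound[OF S] by blast
  \<comment> \<open>Chosen so that the integrated decay \<open>2 * l * \<epsilon> * T\<close> equals
    2 B, twice the bound of the initial value, which is the only end term of the wrong sign. The
    interval starts at 1 because the metric is given for t > 0 only.\<close>
  define T where "T = B / (l * \<epsilon>)"
  have T: "T > 0"
    using B \<epsilon> l by (simp add: T_def)
  have sub: "S \<times> {1..1 + T} \<subseteq> S \<times> {0<..}"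
    by auto
  define N where "N p = integral {1..1 + T} (\<lambda>t. M (p, t))" for p
  note N = C1_on_integral[OF C1_on_subset[OF M sub], folded N_def]
  have intM: "(\<lambda>t. M (p, t)) integrable_on {1..1 + T}" if "p \<in> S" for p
    by (rule integrable_continuous_interval,
        rule continuous_on_compose2[OF C1_on_imp_continuous_on[OF M]])
      (use that in \<open>auto intro!: continuous_intros\<close>)
  have intdM: "(\<lambda>t. fderiv M (p, t) (v, 0)) integrable_on {1..1 + T}" if "p \<in> S" for p v
    by (rule integrable_continuous_interval, rule continuous_on_fderiv[OF M])
      (use that in \<open>auto intro!: continuous_intros\<close>)
  have bl: "bounded_linear (\<lambda>A. v \<bullet> blinfun_apply A w)" for v w :: 'a
    by (intro bounded_linear_intros bounded_linear_inner_right_comp)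
  show ?thesis
  proof (rule that)
    show "C1_on N S" by (rule N)
    \<comment> \<open>Symmetry is claimed for every \<open>p\<close>, also outside \<open>S\<close>,
      so that the identity can later be differentiated at boundary points. Where the integral does
      not exist, its default value 0 is symmetric as well.\<close>
    show "blinfun_adjoint (N p) = N p" for p
    proof (cases "(\<lambda>t. M (p, t)) integrable_on {1..1 + T}")
      case True
      have eq: "v \<bullet> N p w = integral {1..1 + T} (\<lambda>t. v \<bullet> M (p, t) w)" for v w
        using integral_linear[OF True bl[of v w]] by (simp add: N_def o_def)
      have "N p v \<bullet> w = v \<bullet> N p w" for v w
        unfolding inner_commute[of "N p v"] eq by (simp add: Mw inner_commute)
      then show ?thesis by (rule blinfun_adjoint_eqI)
    next
      case False
      then have "N p = 0"
        by (simp add: N_def not_integrable_integral)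
      then show ?thesis
        by (simp add: blinfun_adjoint_eqI)
    qed
    fix p and w :: 'a
    assume p: "p \<in> S" and w: "w \<noteq> 0"
    have low: "\<epsilon> * (w \<bullet> w) \<le> w \<bullet> M (p, t) w" if "t \<in> {1..1 + T}" for t
      using \<epsilon>(2)[of "(p, t)" w] p that by (simp add: Mw)
    have "((\<lambda>t. w \<bullet> M (p, t) w) has_integral w \<bullet> N p w) {1..1 + T}"
      using has_integral_linear[OF integrable_integral[OF intM[OF p]] bl[of w w]]
      by (simp add: N_def o_def)
    moreover have "((\<lambda>t. \<epsilon> * (w \<bullet> w)) has_integral T * (\<epsilon> * (w \<bullet> w))) {1..1 + T}"
      using has_integral_const_real[of "\<epsilon> * (w \<bullet> w)" 1 "1 + T"] T by simp
    ultimately have "T * (\<epsilon> * (w \<bullet> w)) \<le> w \<bullet> N p w"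
      using low has_integral_le by blast
    moreover have "0 < T * (\<epsilon> * (w \<bullet> w))"
      using T \<epsilon> w by simp
    ultimately show "w \<bullet> N p w > 0" by linarith

    \<comment> \<open>\<open>a\<close> integrates to the expression wanted for \<open>N\<close>, and
      \<open>m'\<close> is the derivative of \<open>?m\<close>, which integrates to its end values.
      The contraction hypothesis bounds the sum \<open>a t + m' t\<close>.\<close>
    define a where "a t = w \<bullet> fderiv M (p, t) (X p, 0) w + 2 * (w \<bullet> M (p, t) (J p w))" for t
    define m' where "m' t = w \<bullet> fderiv M (p, t) (0, 1) w" for t
    let ?m = "\<lambda>t. w \<bullet> M (p, t) w"
    have "(a has_integral (w \<bullet> fderiv N p (X p) w + 2 * (w \<bullet> N p (J p w)))) {1..1 + T}"
      unfolding a_def N(2)[OF p]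
      using has_integral_add[OF has_integral_linear[OF integrable_integral[OF intdM[OF p, of "X p"]] bl[of w w]]
          has_integral_mult_right[OF has_integral_linear[OF integrable_integral[OF intM[OF p]] bl[of w "J p w"]], of 2]]
      by (simp add: N_def o_def)
    moreover have "((\<lambda>t. - 2 * l * (\<epsilon> * (w \<bullet> w)) - m' t) has_integral
        (- 2 * l * (\<epsilon> * (w \<bullet> w)) * T - (?m (1 + T) - ?m 1))) {1..1 + T}"
    proof (rule has_integral_diff)
      show "((\<lambda>t. - 2 * l * (\<epsilon> * (w \<bullet> w))) has_integral - 2 * l * (\<epsilon> * (w \<bullet> w)) * T) {1..1 + T}"
        using has_integral_const_real[of "- 2 * l * (\<epsilon> * (w \<bullet> w))" 1 "1 + T"] T by (simp add: mult_ac)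
      show "(m' has_integral (?m (1 + T) - ?m 1)) {1..1 + T}"
      proof (rule fundamental_theorem_of_calculus)
        fix t assume t: "t \<in> {1..1 + T}"
        have d: "(M has_derivative fderiv M (p, t)) (at (p, t))"
          using C1_on_has_derivative[OF M] p t by simp
        have "((\<lambda>t. M (p, t)) has_derivative (\<lambda>s. fderiv M (p, t) (0, s))) (at t)"
          by (rule has_derivative_compose[of "\<lambda>t. (p, t)" "\<lambda>s. (0, s)" t UNIV M "fderiv M (p, t)"])
            (auto intro!: derivative_eq_intros d)
        then have "(?m has_derivative (\<lambda>s. w \<bullet> fderiv M (p, t) (0, s) w)) (at t)"
          by (rule bounded_linear.has_derivative[OF bl])
        moreover have "w \<bullet> fderiv M (p, t) (0, s) w = s *\<^sub>R m' t" for s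
        proof -
          have "fderiv M (p, t) (0, s) = s *\<^sub>R fderiv M (p, t) (0, 1)"
            using linear_cmul[OF has_derivative_linear[OF d], of s "(0, 1)"] by simp
          then show ?thesis
            unfolding m'_def by (simp only: blinfun.scaleR_left inner_scaleR_right real_scaleR_def)
        qed
        ultimately have "(?m has_derivative (\<lambda>s. s *\<^sub>R m' t)) (at t)"
          by (simp only:)
        then show "(?m has_vector_derivative m' t) (at t within {1..1 + T})"
          unfolding has_vector_derivative_def by (rule has_derivative_at_withinI)
      qed (use T in simp)
    qed
    moreover have "a t \<le> - 2 * l * (\<epsilon> * (w \<bullet> w)) - m' t" if t: "t \<in> {1..1 + T}" for t
    proof -
      have q: "(p, t) \<in> S \<times> {0<..}" using p t by simp
      have "fderiv M (p, t) (X p, 1) = fderiv M (p, t) (X p, 0) + fderiv M (p, t) (0, 1)"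
        using linear_add[OF C1_on_linear[OF M q], of "(X p, 0)" "(0, 1)"] by simp
      then have "a t + m' t = w \<bullet> fderiv M (p, t) (X p, 1) w + 2 * (w \<bullet> M (p, t) (J p w))"
        by (simp add: a_def m'_def blinfun.bilinear_simps inner_simps)
      also have "\<dots> = 2 * (\<Theta> (p, t) w \<bullet> (fderiv \<Theta> (p, t) (X p, 1) w + \<Theta> (p, t) (J p w)))"
        unfolding dM[OF q] Mw by (simp add: inner_simps)
      also have "\<dots> \<le> 2 * (- l * (w \<bullet> M (p, t) w))"
        using contr[OF p, of t w] q by (simp add: Mw)
      also have "\<dots> \<le> - 2 * l * (\<epsilon> * (w \<bullet> w))"
        using low[OF t] l by simp
      finally show ?thesis by simp
    qed
    ultimately have "w \<bullet> fderiv N p (X p) w + 2 * (w \<bullet> N p (J p w))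
        \<le> - 2 * l * (\<epsilon> * (w \<bullet> w)) * T - (?m (1 + T) - ?m 1)"
      using has_integral_le by blast
    also have "\<dots> \<le> - 2 * l * (\<epsilon> * (w \<bullet> w)) * T + B * (w \<bullet> w)"
    proof -
      \<comment> \<open>Of the final value only the sign enters, so a metric that grows with time
        does no harm.\<close>
      have "?m (1 + T) \<ge> 0" by (simp add: Mw)
      moreover have "?m 1 \<le> B * (w \<bullet> w)"
      proof -
        have "?m 1 \<le> norm w * norm (M (p, 1) w)"
          by (rule norm_cauchy_schwarz)
        also have "\<dots> \<le> norm w * (B * norm w)"
          using order_trans[OF norm_blinfun mult_right_mono[OF B(2)[OF p]]] by (intro mult_left_mono) auto
        finally show ?thesis
          by (simp add: dot_square_norm power2_eq_square mult_ac)
      qed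
      ultimately show ?thesis by linarith
    qed
    also have "\<dots> = - B * (w \<bullet> w)"
      using l \<epsilon>(1) by (simp add: T_def field_simps)
    also have "\<dots> < 0"
      using B(1) w by simp
    finally show "w \<bullet> fderiv N p (X p) w + 2 * (w \<bullet> N p (J p w)) < 0" .
  qed
qed

section \<open>From a strict metric inequality to contraction\<close>

lemma fderiv_adjoint:
  assumes M: "C1_on M S" "p \<in> S" and sym: "\<And>p. blinfun_adjoint (M p) = M p"
  shows "blinfun_adjoint (fderiv M p v) = fderiv M p v"
proof -
  have "fderiv (\<lambda>p. blinfun_adjoint (M p)) p = (\<lambda>v. blinfun_adjoint (fderiv M p v))"
    by (rule fderiv_eq, rule bounded_linear.has_derivative[OF bounded_linear_blinfun_adjoint])
      (rule C1_on_has_derivative[OF M])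
  then show ?thesis
    by (simp add: sym fun_eq_iff)
qed

lemma blinfun_self_adjoint: "blinfun_adjoint A = A \<Longrightarrow> blinfun_apply A v \<bullet> w = v \<bullet> A w"
  by (metis blinfun_adjoint_left)

lemma blinfun_adjoint_add: "blinfun_adjoint (A + B) = blinfun_adjoint A + blinfun_adjoint B"
  and blinfun_adjoint_diff: "blinfun_adjoint (A - B) = blinfun_adjoint A - blinfun_adjoint B"
  and blinfun_adjoint_scaleR: "blinfun_adjoint (c *\<^sub>R A) = c *\<^sub>R blinfun_adjoint A"
  and blinfun_adjoint_zero: "blinfun_adjoint 0 = 0"
  by (simp_all add: linear_add linear_diff linear_cmul linear_0
      bounded_linear.linear[OF bounded_linear_blinfun_adjoint])

lemma blinfun_adjoint_compose: "blinfun_adjoint (A o\<^sub>L B) = blinfun_adjoint B o\<^sub>L blinfun_adjoint A"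
  by (rule blinfun_eqI, rule vector_eq_ldot[THEN iffD1]) (simp add: blinfun_adjoint_right)

lemma blinfun_adjoint_id: "blinfun_adjoint id_blinfun = id_blinfun"
  by (rule blinfun_adjoint_eqI) simp

text \<open>Expand the square of |w - M w / C|. With C = B^2 / \<epsilon> the quadratic term is at
  most half the size of the bound on the linear one, which leaves (1 - \<epsilon>/C) |w|^2. No
  spectral theory is involved; the \<open>max\<close> spares a proof of \<epsilon> \<le> C.\<close>

lemma norm_id_minus_scaled_le:
  fixes M :: "'a::euclidean_space \<Rightarrow>\<^sub>L 'a"
  assumes "\<epsilon> > 0" "B > 0" "norm M \<le> B" and low: "\<And>w. \<epsilon> * (w \<bullet> w) \<le> w \<bullet> M w"
    and C: "C = B\<^sup>2 / \<epsilon>"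
  shows "norm (id_blinfun - (1 / C) *\<^sub>R M) \<le> sqrt (max 0 (1 - \<epsilon> / C))"
proof (rule norm_blinfun_bound)
  fix w :: 'a
  have C0: "C > 0" using assms(1,2) by (simp add: C)
  have "norm (M w) \<le> B * norm w"
    using order_trans[OF norm_blinfun mult_right_mono[OF assms(3)]] by simp
  then have Mw: "M w \<bullet> M w \<le> B\<^sup>2 * (w \<bullet> w)"
    unfolding dot_square_norm power_mult_distrib[symmetric] by (rule power_mono) simp
  let ?v = "w - (1 / C) *\<^sub>R M w"
  have "?v \<bullet> ?v = w \<bullet> w - (2 / C) * (w \<bullet> M w) + (1 / C)\<^sup>2 * (M w \<bullet> M w)"
    by (simp add: inner_diff_left inner_diff_right inner_commute power2_eq_square)
  also have "\<dots> \<le> w \<bullet> w - (2 / C) * (\<epsilon> * (w \<bullet> w)) + (1 / C)\<^sup>2 * (B\<^sup>2 * (w \<bullet> w))"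
    using C0 low[of w] Mw by (intro add_mono diff_mono mult_left_mono) auto
  also have "(1 / C)\<^sup>2 * (B\<^sup>2 * (w \<bullet> w)) = (1 / C) * (\<epsilon> * (w \<bullet> w))"
    using assms(1,2) by (simp add: C power2_eq_square)
  also have "w \<bullet> w - (2 / C) * (\<epsilon> * (w \<bullet> w)) + (1 / C) * (\<epsilon> * (w \<bullet> w)) = (1 - \<epsilon> / C) * (w \<bullet> w)"
    using C0 by (simp add: field_simps)
  also have "\<dots> \<le> max 0 (1 - \<epsilon> / C) * (w \<bullet> w)"
    by (intro mult_right_mono) auto
  finally have "(norm ?v)\<^sup>2 \<le> (sqrt (max 0 (1 - \<epsilon> / C)) * norm w)\<^sup>2"
    by (simp add: power_mult_distrib dot_square_norm)
  then have "norm ?v \<le> sqrt (max 0 (1 - \<epsilon> / C)) * norm w"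
    by (rule power2_le_imp_le) simp
  then show "norm ((id_blinfun - (1 / C) *\<^sub>R M) w) \<le> sqrt (max 0 (1 - \<epsilon> / C)) * norm w"
    by (simp add: blinfun.bilinear_simps)
qed simp

text \<open>If \<open>A = I - M\<close>, a fixed point \<open>Y\<close> of \<open>Y \<mapsto> (A + Y\<^sup>2)/2\<close> gives the square root \<open>I - Y\<close>
  of \<open>M\<close>; every iterate is a polynomial in \<open>A\<close>, hence as regular as \<open>A\<close>.\<close>

primrec sqrt_iter :: "('p \<Rightarrow> 'a::real_normed_vector \<Rightarrow>\<^sub>L 'a) \<Rightarrow> nat \<Rightarrow> 'p \<Rightarrow> 'a \<Rightarrow>\<^sub>L 'a" where
  "sqrt_iter A 0 = (\<lambda>p. 0)"
| "sqrt_iter A (Suc n) = (\<lambda>p. (1 / 2) *\<^sub>R (A p + (sqrt_iter A n p o\<^sub>L sqrt_iter A n p)))"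

lemma sqrt_iter_C1: "C1_on A S \<Longrightarrow> C1_on (sqrt_iter A n) S"
proof (induction n)
  case (Suc n)
  then show ?case
    unfolding sqrt_iter.simps
    by (intro C1_on_bounded_linear_comp[OF bounded_linear_scaleR_right] C1_on_add
        C1_on_bilinear[OF bounded_bilinear_blinfun_compose]) auto
qed (simp add: C1_on_const)

lemma sqrt_iter_adjoint:
  "(\<And>p. blinfun_adjoint (A p) = A p) \<Longrightarrow> blinfun_adjoint (sqrt_iter A n p) = sqrt_iter A n p"
  by (induction n)
    (simp_all add: blinfun_adjoint_zero blinfun_adjoint_scaleR blinfun_adjoint_add blinfun_adjoint_compose)

lemma sqrt_iter_fderiv:
  fixes A :: "'p::real_normed_vector \<Rightarrow> 'a::real_normed_vector \<Rightarrow>\<^sub>L 'a"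
  assumes A: "C1_on A S" and p: "p \<in> S"
  shows "fderiv (sqrt_iter A (Suc n)) p v = (1 / 2) *\<^sub>R (fderiv A p v +
    ((sqrt_iter A n p o\<^sub>L fderiv (sqrt_iter A n) p v) + (fderiv (sqrt_iter A n) p v o\<^sub>L sqrt_iter A n p)))"
proof -
  note dY = C1_on_has_derivative[OF sqrt_iter_C1[OF A] p, of n]
  show ?thesis
    unfolding sqrt_iter.simps
    by (subst fderiv_eq[OF bounded_linear.has_derivative[OF bounded_linear_scaleR_right
          has_derivative_add[OF C1_on_has_derivative[OF A p]
            bounded_bilinear.FDERIV[OF bounded_bilinear_blinfun_compose dY dY]]]]) (rule refl)
qed

lemma norm_blinfun_compose_mono:
  assumes "norm A \<le> a" "norm B \<le> b"
  shows "norm (A o\<^sub>L B) \<le> a * b"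
proof -
  have "0 \<le> a" using assms(1) norm_ge_zero order_trans by blast
  then show ?thesis
    using order_trans[OF norm_blinfun_compose mult_mono[OF assms]] by simp
qed

text \<open>On the ball of radius r the map Y \<mapsto> (A + Y^2)/2 is r-Lipschitz with r < 1, hence
  geometric convergence. Differentiating the iteration gives an affine recursion with the same
  factor r, whose coefficients themselves converge geometrically. Only derivatives along
  \<open>F\<close> are estimated, since only these enter the rate of a metric.\<close>

lemma sqrt_iter_bounds:
  fixes A :: "'p::real_normed_vector \<Rightarrow> 'a::real_normed_vector \<Rightarrow>\<^sub>L 'a"
  assumes A: "C1_on A S" and q: "0 \<le> q" "q < 1" "\<And>p. p \<in> S \<Longrightarrow> norm (A p) \<le> q"
    and a: "0 \<le> a" "\<And>p. p \<in> S \<Longrightarrow> norm (fderiv A p (F p)) \<le> a"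
  obtains r s K where "0 \<le> r" "r < 1" "0 \<le> s" "s < 1" "0 \<le> K"
    "\<And>n p. p \<in> S \<Longrightarrow> norm (sqrt_iter A n p) \<le> r"
    "\<And>n p. p \<in> S \<Longrightarrow> norm (sqrt_iter A (Suc n) p - sqrt_iter A n p) \<le> r ^ n"
    "\<And>n p. p \<in> S \<Longrightarrow>
      norm (fderiv (sqrt_iter A (Suc n)) p (F p) - fderiv (sqrt_iter A n) p (F p)) \<le> K * s ^ n"
proof -
  \<comment> \<open>The smaller fixed point of r \<mapsto> (q + r^2)/2, the scalar version of the
    iteration; the ball of this radius is therefore invariant.\<close>
  define r where "r = 1 - sqrt (1 - q)"
  have r: "0 \<le> r" "r < 1" "q + r * r = 2 * r"
  proof -
    have "sqrt (1 - q) * sqrt (1 - q) = 1 - q" "0 < sqrt (1 - q)" "sqrt (1 - q) \<le> 1"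
      using q by simp_all
    then show "0 \<le> r" "r < 1" "q + r * r = 2 * r"
      unfolding r_def by (auto simp: algebra_simps)
  qed
  \<comment> \<open>A bound that reproduces itself: the derivative recursion sends b to at most a/2
    + r b, and a + r b = b.\<close>
  define b where "b = a / (1 - r)"
  have b: "0 \<le> b" "a + r * b = b"
    using r a(1) by (auto simp: b_def field_simps)
  \<comment> \<open>The differences E of derivatives satisfy E(n+1) \<le> r E(n) + b r^n. Forcing at
    the same rate r would produce a factor n, so a slightly slower rate between r and 1 is
    taken.\<close>
  define s where "s = (1 + r) / 2"
  have s: "0 \<le> s" "s < 1" "r < s"
    using r by (auto simp: s_def)
  \<comment> \<open>Large enough for the initial difference (a \<le> K) and for the induction step
    (r K + b \<le> s K).\<close>
  define K where "K = a + b / (s - r)"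
  have K: "a \<le> K" "b \<le> K * (s - r)"
  proof -
    show "a \<le> K" using b s by (simp add: K_def)
    have "K * (s - r) = a * (s - r) + b"
      using s by (simp add: K_def field_simps)
    then show "b \<le> K * (s - r)" using a(1) s by simp
  qed
  let ?Y = "sqrt_iter A"
  have Y: "norm (?Y n p) \<le> r" if p: "p \<in> S" for n p
  proof (induction n)
    case (Suc n)
    have "norm (?Y (Suc n) p) \<le> (1 / 2) * (q + r * r)"
      using norm_triangle_le[OF add_mono[OF q(3)[OF p] norm_blinfun_compose_mono[OF Suc Suc]]] by simp
    then show ?case using r(3) by simp
  qed (simp add: r)
  have D: "norm (?Y (Suc n) p - ?Y n p) \<le> r ^ n" if p: "p \<in> S" for n p
  proof (induction n)
    case 0
    show ?case using q(2) q(3)[OF p] by simp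
  next
    case (Suc n)
    have "?Y (Suc (Suc n)) p - ?Y (Suc n) p = (1 / 2) *\<^sub>R
       ((?Y (Suc n) p o\<^sub>L (?Y (Suc n) p - ?Y n p)) + ((?Y (Suc n) p - ?Y n p) o\<^sub>L ?Y n p))"
      unfolding sqrt_iter.simps(2)[of A "Suc n"] sqrt_iter.simps(2)[of A n, THEN fun_cong, of p]
      by (simp add: algebra_simps bounded_bilinear.diff_left[OF bounded_bilinear_blinfun_compose]
          bounded_bilinear.diff_right[OF bounded_bilinear_blinfun_compose])
    also have "norm \<dots> \<le> (1 / 2) * (r * r ^ n + r ^ n * r)"
      using norm_triangle_le[OF add_mono[OF norm_blinfun_compose_mono[OF Y[OF p, of "Suc n"] Suc]
            norm_blinfun_compose_mono[OF Suc Y[OF p, of n]]]] by simp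
    finally show ?case by simp
  qed
  let ?y = "\<lambda>n p. fderiv (?Y n) p (F p)"
  have y: "norm (?y n p) \<le> b" if p: "p \<in> S" for n p
  proof (induction n)
    case 0
    show ?case using b by simp
  next
    case (Suc n)
    have "norm (?y (Suc n) p) \<le> (1 / 2) * (a + (r * b + b * r))"
      unfolding sqrt_iter_fderiv[OF A p]
      using norm_triangle_le[OF add_mono[OF a(2)[OF p] norm_triangle_le[OF
            add_mono[OF norm_blinfun_compose_mono[OF Y[OF p, of n] Suc] norm_blinfun_compose_mono[OF Suc Y[OF p, of n]]]]]]
      by simp
    also have "\<dots> \<le> b"
      using b(2) a(1) by (simp add: mult.commute[of b r])
    finally show ?case .
  qed
  have E: "norm (?y (Suc n) p - ?y n p) \<le> K * s ^ n" if p: "p \<in> S" for n p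
  proof (induction n)
    case 0
    have "norm (?y (Suc 0) p - ?y 0 p) \<le> a"
      unfolding sqrt_iter_fderiv[OF A p] using a(1) a(2)[OF p] by simp
    then show ?case using K(1) by simp
  next
    case (Suc n)
    have "?y (Suc (Suc n)) p - ?y (Suc n) p = (1 / 2) *\<^sub>R
       ((?Y (Suc n) p o\<^sub>L (?y (Suc n) p - ?y n p)) + ((?Y (Suc n) p - ?Y n p) o\<^sub>L ?y n p) +
        ((?y (Suc n) p o\<^sub>L (?Y (Suc n) p - ?Y n p)) + ((?y (Suc n) p - ?y n p) o\<^sub>L ?Y n p)))"
      by (rule trans[OF arg_cong2[of _ _ _ _ "(-)",
              OF sqrt_iter_fderiv[OF A p, of "Suc n"] sqrt_iter_fderiv[OF A p, of n]]])
        (simp del: sqrt_iter.simps add: algebra_simps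
          bounded_bilinear.diff_left[OF bounded_bilinear_blinfun_compose]
          bounded_bilinear.diff_right[OF bounded_bilinear_blinfun_compose])
    also have "norm \<dots> \<le> (1 / 2) * (r * (K * s ^ n) + r ^ n * b + (b * r ^ n + K * s ^ n * r))"
      using norm_triangle_le[OF add_mono[OF
          norm_triangle_le[OF add_mono[OF norm_blinfun_compose_mono[OF Y[OF p, of "Suc n"] Suc]
            norm_blinfun_compose_mono[OF D[OF p, of n] y[OF p, of n]]]]
          norm_triangle_le[OF add_mono[OF norm_blinfun_compose_mono[OF y[OF p, of "Suc n"] D[OF p, of n]]
            norm_blinfun_compose_mono[OF Suc Y[OF p, of n]]]]]] by simp
    also have "\<dots> = r * K * s ^ n + b * r ^ n"
      by (simp add: field_simps)
    also have "\<dots> \<le> r * K * s ^ n + b * s ^ n"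
      using r s b by (intro add_left_mono mult_left_mono power_mono) auto
    also have "\<dots> = (r * K + b) * s ^ n"
      by (simp add: algebra_simps)
    also have "\<dots> \<le> (K * s) * s ^ n"
      using K(2) s(1) by (intro mult_right_mono) (auto simp: algebra_simps)
    finally show ?case by (simp add: mult_ac)
  qed
  show ?thesis
    using that[OF r(1,2) s(1,2) _ Y D E] K(1) a(1) by linarith
qed


text \<open>Compactness of \<open>S\<close> and of the unit sphere gives the strict inequality a
  margin \<open>\<rho>\<close>. Contraction asks for a symmetric \<open>\<Theta>\<close> rather than
  for its square, and a polynomial approximation of the root of M/C suffices: its defect, together
  with the derivative of the defect along \<open>F\<close>, can be made smaller than the
  margin.\<close>

lemma contracting_in_if_strict:
  fixes F :: "'a::euclidean_space \<Rightarrow> 'a" and M :: "'a \<Rightarrow> 'a \<Rightarrow>\<^sub>L 'a"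
  assumes S: "compact S" and M: "C1_on M S" and F: "C1_on F S"
    and sym: "\<And>p. blinfun_adjoint (M p) = M p"
    and pos: "\<And>p w. p \<in> S \<Longrightarrow> w \<noteq> 0 \<Longrightarrow> w \<bullet> M p w > 0"
    and strict: "\<And>p w. p \<in> S \<Longrightarrow> norm w = 1 \<Longrightarrow>
      w \<bullet> fderiv M p (F p) w + 2 * (w \<bullet> M p (fderiv F p w)) < 0"
  shows "\<exists>\<Theta> l. contracting_in (\<lambda>p t. F p) S \<Theta> l"
proof -
  let ?X = "S \<times> (sphere 0 1 :: 'a set)"
  have X: "compact ?X" using S by (intro compact_Times) auto
  have cM: "continuous_on ?X (\<lambda>x. M (fst x))" and cF: "continuous_on ?X (\<lambda>x. F (fst x))"
    by (auto intro!: continuous_on_compose2[OF C1_on_imp_continuous_on[OF M]]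
        continuous_on_compose2[OF C1_on_imp_continuous_on[OF F]] continuous_intros)
  have cJ: "continuous_on ?X (\<lambda>x. fderiv F (fst x) (snd x))"
    by (rule continuous_on_fderiv[OF F]) (auto intro!: continuous_intros)
  have cm: "continuous_on ?X (\<lambda>x. fderiv M (fst x) (F (fst x)))"
    by (rule continuous_on_fderiv[OF M]) (auto intro!: continuous_intros cF)
  obtain \<rho> where \<rho>: "\<rho> > 0" "\<And>x. x \<in> ?X \<Longrightarrow>
      snd x \<bullet> fderiv M (fst x) (F (fst x)) (snd x) + 2 * (snd x \<bullet> M (fst x) (fderiv F (fst x) (snd x))) \<le> - \<rho>"
  proof (rule compact_negative_bound[OF X])
    show "continuous_on ?X (\<lambda>x. snd x \<bullet> fderiv M (fst x) (F (fst x)) (snd x)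
        + 2 * (snd x \<bullet> M (fst x) (fderiv F (fst x) (snd x))))"
      by (intro continuous_intros cM cJ cm)
  qed (use strict in auto)
  obtain \<epsilon> where \<epsilon>: "\<epsilon> > 0" "\<And>x. x \<in> ?X \<Longrightarrow> - (snd x \<bullet> M (fst x) (snd x)) \<le> - \<epsilon>"
  proof (rule compact_negative_bound[OF X])
    show "continuous_on ?X (\<lambda>x. - (snd x \<bullet> M (fst x) (snd x)))"
      by (intro continuous_intros cM)
    show "- (snd x \<bullet> M (fst x) (snd x)) < 0" if "x \<in> ?X" for x
      using pos[of "fst x" "snd x"] that by (cases "snd x = 0") (auto simp: mem_Times_iff)
  qed blast
  have low: "\<epsilon> * (w \<bullet> w) \<le> w \<bullet> M p w" if p: "p \<in> S" for p w
  proof (cases "w = 0")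
    case False
    let ?u = "(1 / norm w) *\<^sub>R w"
    have "\<epsilon> \<le> ?u \<bullet> M p ?u"
      using \<epsilon>(2)[of "(p, ?u)"] p False by simp
    then have "\<epsilon> * (norm w)\<^sup>2 \<le> (?u \<bullet> M p ?u) * (norm w)\<^sup>2"
      by (rule mult_right_mono) simp
    also have "\<dots> = w \<bullet> M p w"
      using False by (simp add: blinfun.scaleR_right power2_eq_square)
    finally show ?thesis by (simp add: dot_square_norm)
  qed simp
  obtain B where B: "B > 0" "\<And>p. p \<in> S \<Longrightarrow> norm (M p) \<le> B"
    using compact_bound[OF S C1_on_imp_continuous_on[OF M]] by blast
  \<comment> \<open>Rescaling by \<open>C\<close> makes the norm of I - M/C at most some q < 1, as
    the iteration requires; the sign of the strict inequality is unaffected.\<close>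
  define C where "C = B\<^sup>2 / \<epsilon>"
  have C: "C > 0" using B(1) \<epsilon>(1) by (simp add: C_def)
  define A where "A p = id_blinfun - (1 / C) *\<^sub>R M p" for p
  have A: "C1_on A S"
  proof -
    have "C1_on (\<lambda>p. id_blinfun + (- 1 / C) *\<^sub>R M p) S"
      by (intro C1_on_add C1_on_const C1_on_bounded_linear_comp[OF bounded_linear_scaleR_right] M)
    then show ?thesis by (simp add: A_def[abs_def])
  qed
  have dA: "fderiv A p v = - (1 / C) *\<^sub>R fderiv M p v" if "p \<in> S" for p v
  proof -
    have "(A has_derivative (\<lambda>v. 0 - (1 / C) *\<^sub>R fderiv M p v)) (at p)"
      unfolding A_def
      by (intro has_derivative_diff has_derivative_const has_derivative_scaleR_right
          C1_on_has_derivative[OF M that])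
    then show ?thesis by (simp add: fderiv_eq)
  qed
  define q where "q = sqrt (max 0 (1 - \<epsilon> / C))"
  have q: "0 \<le> q" "q < 1" "\<And>p. p \<in> S \<Longrightarrow> norm (A p) \<le> q"
  proof -
    show "0 \<le> q" "q < 1" using \<epsilon>(1) C by (auto simp: q_def)
    show "norm (A p) \<le> q" if "p \<in> S" for p
      unfolding A_def q_def
      using norm_id_minus_scaled_le[OF \<epsilon>(1) B(1) B(2)[OF that] low[OF that] C_def] .
  qed
  have "continuous_on S (\<lambda>p. fderiv A p (F p))"
    by (rule continuous_on_fderiv[OF A])
      (auto intro!: continuous_intros C1_on_imp_continuous_on[OF F])
  then obtain a where a: "a > 0" "\<And>p. p \<in> S \<Longrightarrow> norm (fderiv A p (F p)) \<le> a"
    using compact_bound[OF S] by blast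
  let ?Y = "sqrt_iter A"
  let ?y = "\<lambda>n p. fderiv (?Y n) p (F p)"
  obtain r s K where r: "0 \<le> r" "r < 1" and s: "0 \<le> s" "s < 1" and K: "0 \<le> K"
    and Y: "\<And>n p. p \<in> S \<Longrightarrow> norm (?Y n p) \<le> r"
    and D: "\<And>n p. p \<in> S \<Longrightarrow> norm (?Y (Suc n) p - ?Y n p) \<le> r ^ n"
    and E: "\<And>n p. p \<in> S \<Longrightarrow> norm (?y (Suc n) p - ?y n p) \<le> K * s ^ n"
    using sqrt_iter_bounds[OF A q less_imp_le[OF a(1)] a(2)] by metis
  obtain j where j: "j > 0" "\<And>x. x \<in> ?X \<Longrightarrow> norm (fderiv F (fst x) (snd x)) \<le> j"
    using compact_bound[OF X cJ] by blast
  \<comment> \<open>The left-hand side is the total error caused by the defect of the approximate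
    root, \<open>j\<close> bounding the Jacobian on unit vectors. Half of the scaled margin
    \<open>\<rho> / C\<close> is spent on it.\<close>
  have "(\<lambda>n. 2 * (K * s ^ n) + 4 * (r ^ n * j)) \<longlonglongrightarrow> 2 * (K * 0) + 4 * (0 * j)"
    by (intro tendsto_intros LIMSEQ_realpow_zero r s)
  then have "eventually (\<lambda>n. 2 * (K * s ^ n) + 4 * (r ^ n * j) < \<rho> / C / 2) sequentially"
    using \<rho>(1) C by (intro order_tendstoD) auto
  then obtain n where n: "2 * (K * s ^ n) + 4 * (r ^ n * j) < \<rho> / C / 2"
    by (auto simp: eventually_sequentially)
  \<comment> \<open>The iteration yields the exact identity \<open>\<Theta>\<^sup>2 = M/C + 2
    (Y\<^sub>n\<^sub>+\<^sub>1 - Y\<^sub>n)\<close>, so the defect is one iteration step. The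
    formulas labelled 1 and 2 below are this identity differentiated along \<open>F\<close> and
    applied to the Jacobian.\<close>
  define \<Theta> where "\<Theta> p = id_blinfun - ?Y n p" for p
  have symA: "blinfun_adjoint (A p) = A p" for p
    by (simp add: A_def blinfun_adjoint_diff blinfun_adjoint_scaleR blinfun_adjoint_id sym)
  have symY: "blinfun_adjoint (?Y n p) = ?Y n p" for n p
    by (rule sqrt_iter_adjoint[OF symA])
  have sym\<Theta>: "blinfun_adjoint (\<Theta> p) = \<Theta> p" for p
    by (simp add: \<Theta>_def blinfun_adjoint_diff blinfun_adjoint_id symY)
  have \<Theta>: "C1_on \<Theta> S"
  proof -
    have "C1_on (\<lambda>p. id_blinfun + (- 1) *\<^sub>R ?Y n p) S"
      by (intro C1_on_add C1_on_const C1_on_bounded_linear_comp[OF bounded_linear_scaleR_right]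
          sqrt_iter_C1 A)
    then show ?thesis by (simp add: \<Theta>_def[abs_def])
  qed
  have d\<Theta>: "fderiv \<Theta> p v = - fderiv (?Y n) p v" if "p \<in> S" for p v
  proof -
    have "(\<Theta> has_derivative (\<lambda>v. 0 - fderiv (?Y n) p v)) (at p)"
      unfolding \<Theta>_def
      by (intro has_derivative_diff has_derivative_const C1_on_has_derivative[OF sqrt_iter_C1[OF A] that])
    then show ?thesis by (simp add: fderiv_eq)
  qed
  have \<Theta>le: "norm (\<Theta> p w) \<le> 2 * norm w" and \<Theta>ge: "(1 - r) * norm w \<le> norm (\<Theta> p w)"
    and \<Theta>pos: "(1 - r) * (norm w)\<^sup>2 \<le> w \<bullet> \<Theta> p w" if p: "p \<in> S" for p w
  proof -
    have Yw: "norm (?Y n p w) \<le> r * norm w"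
      using order_trans[OF norm_blinfun mult_right_mono[OF Y[OF p]]] by simp
    have eq: "\<Theta> p w = w - ?Y n p w"
      by (simp add: \<Theta>_def blinfun.diff_left)
    have "r * norm w \<le> 1 * norm w"
      using r by (intro mult_right_mono) auto
    then show "norm (\<Theta> p w) \<le> 2 * norm w"
      using norm_triangle_ineq4[of w "?Y n p w"] Yw unfolding eq by linarith
    show "(1 - r) * norm w \<le> norm (\<Theta> p w)"
      using norm_triangle_ineq2[of w "?Y n p w"] Yw unfolding eq by (simp add: algebra_simps)
    have "w \<bullet> ?Y n p w \<le> norm w * (r * norm w)"
      using order_trans[OF norm_cauchy_schwarz mult_left_mono[OF Yw]] by simp
    then show "(1 - r) * (norm w)\<^sup>2 \<le> w \<bullet> \<Theta> p w"
      unfolding eq by (simp add: inner_diff_right dot_square_norm power2_eq_square algebra_simps)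
  qed
  \<comment> \<open>After the error is paid, twice the left-hand side is at most
    \<open>- (\<rho> / C / 2)\<close>, and on unit vectors the square of |\<Theta> w| is at most 4;
    together these give the factor 16.\<close>
  have rate: "\<Theta> p w \<bullet> (fderiv \<Theta> p (F p) w + \<Theta> p (fderiv F p w)) \<le> - (\<rho> / C / 16) * (\<Theta> p w \<bullet> \<Theta> p w)"
    if p: "p \<in> S" and w: "norm w = 1" for p w
  proof -
    let ?J = "fderiv F p w"
    have yadj: "?y n p v \<bullet> u = v \<bullet> ?y n p u" for v u
      using blinfun_self_adjoint[OF fderiv_adjoint[OF sqrt_iter_C1[OF A] p symY]] .
    have Yadj: "?Y n p v \<bullet> u = v \<bullet> ?Y n p u" for v u
      using blinfun_self_adjoint[OF symY] .
    have 1: "2 * (\<Theta> p w \<bullet> fderiv \<Theta> p (F p) w) =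
      (w \<bullet> fderiv M p (F p) w) / C + 2 * (w \<bullet> (?y (Suc n) p - ?y n p) w)"
    proof -
      have "w \<bullet> (?y (Suc n) p) w = (1 / 2) * (- (1 / C) * (w \<bullet> fderiv M p (F p) w)
          + (w \<bullet> ?Y n p (?y n p w) + w \<bullet> ?y n p (?Y n p w)))"
        unfolding sqrt_iter_fderiv[OF A p] dA[OF p]
        by (simp add: blinfun.bilinear_simps inner_simps)
      moreover have "w \<bullet> ?y n p (?Y n p w) = w \<bullet> ?Y n p (?y n p w)"
        by (metis yadj Yadj inner_commute)
      ultimately show ?thesis
        unfolding d\<Theta>[OF p] \<Theta>_def
        by (simp del: sqrt_iter.simps add: blinfun.bilinear_simps inner_simps Yadj)
    qed
    have 2: "2 * (\<Theta> p w \<bullet> \<Theta> p ?J) = 2 * (w \<bullet> M p ?J) / C + 4 * (w \<bullet> (?Y (Suc n) p - ?Y n p) ?J)"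
    proof -
      have "?Y (Suc n) p ?J = (1 / 2) *\<^sub>R (?J - (1 / C) *\<^sub>R M p ?J + ?Y n p (?Y n p ?J))"
        by (simp add: A_def blinfun.bilinear_simps)
      then show ?thesis
        unfolding \<Theta>_def
        by (simp del: sqrt_iter.simps
            add: blinfun.bilinear_simps inner_simps Yadj add_divide_distrib diff_divide_distrib)
    qed
    have x: "(p, w) \<in> ?X" using p w by simp
    have "w \<bullet> (?y (Suc n) p - ?y n p) w \<le> K * s ^ n"
    proof -
      have "w \<bullet> (?y (Suc n) p - ?y n p) w \<le> norm w * (norm (?y (Suc n) p - ?y n p) * norm w)"
        by (rule order_trans[OF norm_cauchy_schwarz mult_left_mono[OF norm_blinfun]]) simp
      then show ?thesis using E[OF p, of n] w by simp
    qed
    moreover have "w \<bullet> (?Y (Suc n) p - ?Y n p) ?J \<le> r ^ n * j"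
    proof -
      have "w \<bullet> (?Y (Suc n) p - ?Y n p) ?J \<le> norm w * (norm (?Y (Suc n) p - ?Y n p) * norm ?J)"
        by (rule order_trans[OF norm_cauchy_schwarz mult_left_mono[OF norm_blinfun]]) simp
      also have "\<dots> \<le> r ^ n * j"
        using mult_mono[OF D[OF p, of n] j(2)[OF x]] w r by simp
      finally show ?thesis .
    qed
    moreover have "(w \<bullet> fderiv M p (F p) w) / C + 2 * (w \<bullet> M p ?J) / C \<le> - (\<rho> / C)"
      using divide_right_mono[OF \<rho>(2)[OF x], of C] C by (simp add: add_divide_distrib)
    moreover have "L1 + L2 \<le> - (d / 2)"
      if "x \<le> k1" "y \<le> k2" "m1 + m2 \<le> - d" "2 * k1 + 4 * k2 < d / 2"
        "L1 = m1 + 2 * x" "L2 = m2 + 4 * y" for x y k1 k2 m1 m2 d L1 L2 :: real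
      using that by linarith
    ultimately have "2 * (\<Theta> p w \<bullet> (fderiv \<Theta> p (F p) w + \<Theta> p ?J)) \<le> - (\<rho> / C / 2)"
      using n 1 2 unfolding inner_add_right distrib_left by blast
    moreover have "(\<rho> / C / 8) * (\<Theta> p w \<bullet> \<Theta> p w) \<le> (\<rho> / C / 8) * 4"
    proof (rule mult_left_mono)
      have "(norm (\<Theta> p w))\<^sup>2 \<le> 2\<^sup>2"
        using \<Theta>le[OF p, of w] w by (intro power_mono) auto
      then show "\<Theta> p w \<bullet> \<Theta> p w \<le> 4" by (simp add: dot_square_norm)
    qed (use \<rho>(1) C in simp)
    ultimately show ?thesis by argo
  qed
  have rate': "\<Theta> p w \<bullet> (fderiv \<Theta> p (F p) w + \<Theta> p (fderiv F p w)) \<le> - (\<rho> / C / 16) * (\<Theta> p w \<bullet> \<Theta> p w)"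
    if p: "p \<in> S" for p w
  proof (cases "w = 0")
    case False
    define u c where "u = (1 / norm w) *\<^sub>R w" and "c = norm w"
    have w: "w = c *\<^sub>R u" and u: "norm u = 1"
      using False by (simp_all add: u_def c_def)
    have J: "fderiv F p (c *\<^sub>R u) = c *\<^sub>R fderiv F p u"
      using linear_cmul[OF C1_on_linear[OF F p]] .
    have "c\<^sup>2 * (\<Theta> p u \<bullet> (fderiv \<Theta> p (F p) u + \<Theta> p (fderiv F p u)))
        \<le> c\<^sup>2 * (- (\<rho> / C / 16) * (\<Theta> p u \<bullet> \<Theta> p u))"
      by (rule mult_left_mono[OF rate[OF p u]]) simp
    then show ?thesis
      unfolding w J
      by (simp add: blinfun.scaleR_right scaleR_add_right[symmetric] power2_eq_square mult_ac)
  qed simp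
  have "contracting_in (\<lambda>p t. F p) S (\<lambda>p t. \<Theta> p) (\<rho> / C / 16)"
    unfolding contracting_in_def
  proof (intro conjI ballI allI impI)
    show "0 < \<rho> / C / 16" using \<rho>(1) C by simp
    show "metric_on (\<lambda>(x, t :: real). \<Theta> x) (S \<times> {0<..})"
      unfolding metric_on_def
    proof (intro conjI ballI allI impI)
      show "C1_on (\<lambda>(x, t). \<Theta> x) (S \<times> {0<..})"
        unfolding case_prod_beta by (rule C1_on_compose[OF \<Theta> C1_on_fst]) auto
      show "blinfun_apply (case p of (x, t) \<Rightarrow> \<Theta> x) v \<bullet> w = v \<bullet> blinfun_apply (case p of (x, t) \<Rightarrow> \<Theta> x) w"
        for p :: "'a \<times> real" and v w :: 'a
        unfolding case_prod_beta by (rule blinfun_self_adjoint[OF sym\<Theta>])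
      show "0 < v \<bullet> blinfun_apply (case p of (x, t) \<Rightarrow> \<Theta> x) v"
        if "p \<in> S \<times> {0<..}" "v \<noteq> 0" for p :: "'a \<times> real" and v :: 'a
      proof -
        have "0 < (1 - r) * (norm v)\<^sup>2" using r(2) that(2) by simp
        then show ?thesis
          unfolding case_prod_beta using \<Theta>pos[of "fst p" v] that(1) by (auto simp: mem_Times_iff)
      qed
    next
      show "\<exists>\<epsilon>>0. \<forall>p\<in>S \<times> ({0<..} :: real set). \<forall>v. \<epsilon> * (v \<bullet> v)
          \<le> blinfun_apply (case p of (x, t) \<Rightarrow> \<Theta> x) v \<bullet> blinfun_apply (case p of (x, t) \<Rightarrow> \<Theta> x) v"
      proof (intro exI[of _ "(1 - r)\<^sup>2"] conjI ballI allI)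
        show "0 < (1 - r)\<^sup>2" using r(2) by simp
        fix p :: "'a \<times> real" and v :: 'a
        assume "p \<in> S \<times> {0<..}"
        then have "((1 - r) * norm v)\<^sup>2 \<le> (norm (\<Theta> (fst p) v))\<^sup>2"
          using \<Theta>ge[of "fst p" v] r(2) by (intro power_mono) (auto simp: mem_Times_iff)
        then show "(1 - r)\<^sup>2 * (v \<bullet> v) \<le> blinfun_apply (case p of (x, t) \<Rightarrow> \<Theta> x) v \<bullet> blinfun_apply (case p of (x, t) \<Rightarrow> \<Theta> x) v"
          by (simp add: case_prod_beta power_mult_distrib dot_square_norm)
      qed
    qed
    fix p :: 'a and t :: real
    assume p: "p \<in> S" and t: "0 < t"
    show "(\<lambda>\<xi>. F \<xi>) differentiable at p"
      using C1_on_has_derivative[OF F p] by (rule differentiableI)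
    fix v :: 'a
    \<comment> \<open>The lower bound on |\<Theta> w| gives injectivity, and finite dimension then
      surjectivity, so the \<open>inv\<close> in the definition of contraction is a genuine
      inverse.\<close>
    have "inj (\<Theta> p)"
    proof (rule injI)
      fix x y assume "\<Theta> p x = \<Theta> p y"
      then have "\<Theta> p (x - y) = 0" by (simp add: blinfun.diff_right)
      then show "x = y" using \<Theta>ge[OF p, of "x - y"] r(2) by (simp add: mult_le_0_iff)
    qed
    then have "surj (\<Theta> p)"
      by (rule linear_inj_imp_surj[OF bounded_linear.linear[OF blinfun.bounded_linear_right]])
    then have v: "\<Theta> p (inv (\<Theta> p) v) = v"
      by (rule surj_f_inv_f)
    have "((\<lambda>q. \<Theta> (fst q)) has_derivative (\<lambda>v. fderiv \<Theta> p (fst v))) (at (p, t))"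
      by (rule has_derivative_compose[of fst fst "(p, t)" UNIV \<Theta> "fderiv \<Theta> p"])
        (simp_all add: C1_on_has_derivative[OF \<Theta> p] bounded_linear_imp_has_derivative bounded_linear_fst)
    then have "metric_rate (\<lambda>p t. F p) (\<lambda>p t. \<Theta> p) p t = fderiv \<Theta> p (F p)"
      unfolding metric_rate_def case_prod_beta by (simp add: fderiv_eq)
    then show "let w = inv (blinfun_apply (\<Theta> p)) v; J = fderiv (\<lambda>\<xi>. F \<xi>) p
       in v \<bullet> (metric_rate (\<lambda>p t. F p) (\<lambda>p t. \<Theta> p) p t w + \<Theta> p (J w)) \<le> - (\<rho> / C / 16) * (v \<bullet> v)"
      using rate'[OF p, of "inv (\<Theta> p) v"] by (simp only: v Let_def)
  qed
  then show ?thesis by blast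
qed

section \<open>Two time scales\<close>

lemma has_derivative_quadratic_form:
  assumes N: "(N has_derivative N') (at p)" and c: "(c has_derivative c') (at p)"
    and sym: "blinfun_adjoint (N p) = N p"
  shows "((\<lambda>p. c p \<bullet> blinfun_apply (N p) (c p)) has_derivative
    (\<lambda>v. c p \<bullet> blinfun_apply (N' v) (c p) + 2 * (c p \<bullet> N p (c' v)))) (at p)"
proof -
  have "c' v \<bullet> N p (c p) = c p \<bullet> N p (c' v)" for v
    by (metis blinfun_self_adjoint[OF sym] inner_commute)
  then have "(\<lambda>v. c p \<bullet> (N p (c' v) + N' v (c p)) + c' v \<bullet> N p (c p)) =
      (\<lambda>v. c p \<bullet> blinfun_apply (N' v) (c p) + 2 * (c p \<bullet> N p (c' v)))"
    by (auto simp: inner_add_right)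
  then show ?thesis
    using has_derivative_inner[OF c blinfun.FDERIV[OF N c]] by simp
qed

text \<open>The block-diagonal form of P and k N, pulled back along (dx, dz) \<mapsto> (dx, dz - H
  dx). Written as congruences, it is symmetric whenever \<open>P\<close> and \<open>N\<close> are,
  and differentiable by the product rules.\<close>

definition block_metric ::
  "('a::euclidean_space \<Rightarrow> 'a \<Rightarrow>\<^sub>L 'a) \<Rightarrow> ('a \<times> 'b::euclidean_space \<Rightarrow> 'b \<Rightarrow>\<^sub>L 'b) \<Rightarrow>
   ('a \<Rightarrow> 'a \<Rightarrow>\<^sub>L 'b) \<Rightarrow> ('a \<times> 'b \<Rightarrow> real) \<Rightarrow> real \<Rightarrow> 'a \<times> 'b \<Rightarrow> ('a \<times> 'b) \<Rightarrow>\<^sub>L ('a \<times> 'b)" where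
  "block_metric P N H V k p = exp (V p) *\<^sub>R
     ((blinfun_adjoint fst_blinfun o\<^sub>L (P (fst p) o\<^sub>L fst_blinfun)) +
      k *\<^sub>R (blinfun_adjoint (snd_blinfun - (H (fst p) o\<^sub>L fst_blinfun)) o\<^sub>L
        (N p o\<^sub>L (snd_blinfun - (H (fst p) o\<^sub>L fst_blinfun)))))"

lemma block_metric_form:
  "w \<bullet> block_metric P N H V k p v = exp (V p) *
     (fst w \<bullet> P (fst p) (fst v) +
      k * ((snd w - H (fst p) (fst w)) \<bullet> N p (snd v - H (fst p) (fst v))))"
  unfolding block_metric_def
  by (simp add: blinfun.add_left blinfun.scaleR_left blinfun.diff_left inner_add_right
      blinfun_adjoint_right)

lemma block_metric_adjoint:
  assumes "\<And>x. blinfun_adjoint (P x) = P x" "\<And>p. blinfun_adjoint (N p) = N p"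
  shows "blinfun_adjoint (block_metric P N H V k p) = block_metric P N H V k p"
proof (rule blinfun_adjoint_eqI)
  fix v w :: "'a \<times> 'b"
  have sym: "a \<bullet> P x b = b \<bullet> P x a" "c \<bullet> N q d = d \<bullet> N q c" for a b x c d q
    by (metis assms blinfun_self_adjoint inner_commute)+
  show "block_metric P N H V k p v \<bullet> w = v \<bullet> block_metric P N H V k p w"
    unfolding inner_commute[of "block_metric P N H V k p v"] block_metric_form
    using sym by metis
qed

lemma block_metric_C1:
  fixes P :: "'a::euclidean_space \<Rightarrow> 'a \<Rightarrow>\<^sub>L 'a" and N :: "'a \<times> 'b::euclidean_space \<Rightarrow> 'b \<Rightarrow>\<^sub>L 'b"
  assumes P: "C1_on P Bx" and N: "C1_on N (Bx \<times> Bz)" and H: "C1_on H Bx"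
    and V: "C1_on V (Bx \<times> Bz)"
  shows "C1_on (block_metric P N H V k) (Bx \<times> Bz)"
proof -
  note comp = C1_on_bilinear[OF bounded_bilinear_blinfun_compose]
  have P': "C1_on (\<lambda>p. P (fst p)) (Bx \<times> Bz)" and H': "C1_on (\<lambda>p. H (fst p)) (Bx \<times> Bz)"
    by (rule C1_on_compose[OF P C1_on_fst] C1_on_compose[OF H C1_on_fst]; force)+
  have "C1_on (\<lambda>p. snd_blinfun + (- 1) *\<^sub>R (H (fst p) o\<^sub>L fst_blinfun)) (Bx \<times> Bz)"
    by (intro C1_on_add C1_on_const C1_on_bounded_linear_comp[OF bounded_linear_scaleR_right] comp H')
  then have S: "C1_on (\<lambda>p. snd_blinfun - (H (fst p) o\<^sub>L fst_blinfun)) (Bx \<times> Bz)"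
    by simp
  show ?thesis
    unfolding block_metric_def[abs_def]
    by (intro C1_on_bilinear[OF bounded_bilinear_scaleR C1_on_exp[OF V]] C1_on_add comp C1_on_const
        C1_on_bounded_linear_comp[OF bounded_linear_scaleR_right]
        C1_on_bounded_linear_comp[OF bounded_linear_blinfun_adjoint] P' N S)
qed

text \<open>For a fixed vector w the component dz - H dx still varies with the base point through
  \<open>H\<close>; this is the source of the term with \<open>fderiv H\<close>. The scalar form is
  differentiated directly, and uniqueness of derivatives carries the result over to the operator
  field.\<close>

lemma block_metric_fderiv:
  fixes P :: "'a::euclidean_space \<Rightarrow> 'a \<Rightarrow>\<^sub>L 'a" and N :: "'a \<times> 'b::euclidean_space \<Rightarrow> 'b \<Rightarrow>\<^sub>L 'b"
    and H :: "'a \<Rightarrow> 'a \<Rightarrow>\<^sub>L 'b"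
  assumes P: "C1_on P Bx" and N: "C1_on N (Bx \<times> Bz)" and H: "C1_on H Bx"
    and V: "C1_on V (Bx \<times> Bz)" and sym: "\<And>p. blinfun_adjoint (N p) = N p"
    and p: "p \<in> Bx \<times> Bz" and c: "c = snd w - H (fst p) (fst w)"
  shows "w \<bullet> fderiv (block_metric P N H V k) p v w = exp (V p) *
    (fderiv V p v * (fst w \<bullet> P (fst p) (fst w) + k * (c \<bullet> N p c)) +
     (fst w \<bullet> fderiv P (fst p) (fst v) (fst w) +
      k * (c \<bullet> fderiv N p v c - 2 * (c \<bullet> N p (fderiv H (fst p) (fst v) (fst w))))))"
proof -
  have x: "fst p \<in> Bx" using p by auto
  have bl: "bounded_linear (\<lambda>A. u \<bullet> blinfun_apply A u')" for u u' :: "'c::euclidean_space"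
    by (intro bounded_linear_intros bounded_linear_inner_right_comp)
  have dfst: "(fst has_derivative fst) (at p)"
    by (rule bounded_linear_imp_has_derivative[OF bounded_linear_fst])
  have dP: "((\<lambda>p. fst w \<bullet> P (fst p) (fst w)) has_derivative
      (\<lambda>v. fst w \<bullet> fderiv P (fst p) (fst v) (fst w))) (at p)"
    by (rule bounded_linear.has_derivative[OF bl],
        rule has_derivative_compose[OF dfst C1_on_has_derivative[OF P x]])
  have "((\<lambda>p. snd w - blinfun_apply (H (fst p)) (fst w)) has_derivative
      (\<lambda>v. 0 - fderiv H (fst p) (fst v) (fst w))) (at p)"
    by (intro has_derivative_diff has_derivative_const
        bounded_linear.has_derivative[OF blinfun.bounded_linear_left]
        has_derivative_compose[OF dfst C1_on_has_derivative[OF H x]])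
  then have dG: "((\<lambda>p. (snd w - H (fst p) (fst w)) \<bullet> N p (snd w - H (fst p) (fst w))) has_derivative
      (\<lambda>v. c \<bullet> fderiv N p v c + 2 * (c \<bullet> N p (0 - fderiv H (fst p) (fst v) (fst w))))) (at p)"
    unfolding c by (intro has_derivative_quadratic_form C1_on_has_derivative[OF N p] sym)
  have dV: "((\<lambda>p. exp (V p)) has_derivative (\<lambda>v. exp (V p) * fderiv V p v)) (at p)"
    using has_derivative_compose[OF C1_on_has_derivative[OF V p], of exp "\<lambda>y. exp (V p) * y"]
      DERIV_exp[of "V p"] unfolding has_field_derivative_def by simp
  have d1: "((\<lambda>p. w \<bullet> block_metric P N H V k p w) has_derivative
      (\<lambda>v. exp (V p) * (fst w \<bullet> fderiv P (fst p) (fst v) (fst w) +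
          k * (c \<bullet> fderiv N p v c + 2 * (c \<bullet> N p (0 - fderiv H (fst p) (fst v) (fst w))))) +
        exp (V p) * fderiv V p v * (fst w \<bullet> P (fst p) (fst w) + k * (c \<bullet> N p c)))) (at p)"
    unfolding block_metric_form
    by (rule has_derivative_eq_rhs[OF has_derivative_mult[OF dV
            has_derivative_add[OF dP has_derivative_mult_right[OF dG]]]]) (simp add: c)
  have d2: "((\<lambda>p. w \<bullet> block_metric P N H V k p w) has_derivative
      (\<lambda>v. w \<bullet> fderiv (block_metric P N H V k) p v w)) (at p)"
    by (rule bounded_linear.has_derivative[OF bl],
        rule C1_on_has_derivative[OF block_metric_C1[OF P N H V] p])
  show ?thesis
    unfolding fun_cong[OF has_derivative_unique[OF d2 d1], of v]
    by (simp add: blinfun.minus_right algebra_simps)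
qed

text \<open>Krasovskii's function \<open>V = g\<^sup>T N g\<close> decreases at rate \<open>1/\<mu>\<close> off the slow manifold, and so the
  factor \<open>exp V\<close> of the metric compensates there for the lack of contraction of the slow block.\<close>

lemma two_time_scale_contraction:
  fixes P :: "'a::euclidean_space \<Rightarrow> 'a \<Rightarrow>\<^sub>L 'a" and N :: "'a \<times> 'b::euclidean_space \<Rightarrow> 'b \<Rightarrow>\<^sub>L 'b"
    and f :: "'a \<times> 'b \<Rightarrow> 'a" and g :: "'a \<times> 'b \<Rightarrow> 'b" and H :: "'a \<Rightarrow> 'a \<Rightarrow>\<^sub>L 'b"
  assumes Bx: "compact Bx" and Bz: "compact Bz"
    and f: "C1_on f (Bx \<times> Bz)" and g: "C1_on g (Bx \<times> Bz)" and H: "C1_on H Bx"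
    and P: "C1_on P Bx" "\<And>x. blinfun_adjoint (P x) = P x"
      "\<And>x a. x \<in> Bx \<Longrightarrow> a \<noteq> 0 \<Longrightarrow> a \<bullet> P x a > 0"
    and N: "C1_on N (Bx \<times> Bz)" "\<And>p. blinfun_adjoint (N p) = N p"
      "\<And>p c. p \<in> Bx \<times> Bz \<Longrightarrow> c \<noteq> 0 \<Longrightarrow> c \<bullet> N p c > 0"
    and slow: "\<And>p a. p \<in> Bx \<times> Bz \<Longrightarrow> g p = 0 \<Longrightarrow> a \<noteq> 0 \<Longrightarrow>
      a \<bullet> fderiv P (fst p) (f p) a + 2 * (a \<bullet> P (fst p) (fderiv f p (a, H (fst p) a))) < 0"
    and tangent: "\<And>p a. p \<in> Bx \<times> Bz \<Longrightarrow> g p = 0 \<Longrightarrow> fderiv g p (a, H (fst p) a) = 0"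
    and fast: "\<And>p c. p \<in> Bx \<times> Bz \<Longrightarrow> c \<noteq> 0 \<Longrightarrow>
      c \<bullet> fderiv N p (0, g p) c + 2 * (c \<bullet> N p (fderiv g p (0, c))) < 0"
  obtains \<mu>0 where "0 < \<mu>0" "\<mu>0 \<le> 1"
    "\<And>\<mu>. 0 < \<mu> \<Longrightarrow> \<mu> \<le> \<mu>0 \<Longrightarrow>
      \<exists>\<Theta> l. contracting_in (\<lambda>p t. (f p, (1 / \<mu>) *\<^sub>R g p)) (Bx \<times> Bz) \<Theta> l"
proof -
  let ?S = "Bx \<times> Bz"
  let ?X = "?S \<times> (sphere 0 1 :: ('a \<times> 'b) set)"
  have S: "compact ?S" and X: "compact ?X"
    using Bx Bz by (simp_all add: compact_Times)
  define V where "V p = g p \<bullet> N p (g p)" for p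
  have V: "C1_on V ?S"
    unfolding V_def[abs_def]
    by (intro C1_on_bilinear[OF bounded_bilinear_inner] C1_on_bilinear[OF bounded_bilinear_blinfun_apply] g N)
  have dV: "fderiv V p v = g p \<bullet> fderiv N p v (g p) + 2 * (g p \<bullet> N p (fderiv g p v))"
    if p: "p \<in> ?S" for p v
    unfolding V_def[abs_def]
    by (subst fderiv_eq[OF has_derivative_quadratic_form[OF C1_on_has_derivative[OF N(1) p]
            C1_on_has_derivative[OF g p] N(2)]]) simp
  \<comment> \<open>\<open>c\<close> is \<zeta>, \<open>Wx\<close> and \<open>Wz\<close> are the two
    blocks of the form without weights. \<open>Vs\<close> and \<open>Vf\<close> are the rates of V
    along the slow field (f, 0) and the fast field (0, g). \<open>Ax\<close> is the rate of the slow
    block; \<open>Af\<close> and \<open>As\<close> are the parts of the rate of the \<zeta>-block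
    with and without the factor 1/\<mu>.\<close>
  define c where "c x = snd (snd x) - H (fst (fst x)) (fst (snd x))" for x :: "('a \<times> 'b) \<times> ('a \<times> 'b)"
  define Wx where "Wx x = fst (snd x) \<bullet> P (fst (fst x)) (fst (snd x))" for x :: "('a \<times> 'b) \<times> ('a \<times> 'b)"
  define Wz where "Wz x = c x \<bullet> N (fst x) (c x)" for x
  define Vs where "Vs x = fderiv V (fst x) (f (fst x), 0)" for x :: "('a \<times> 'b) \<times> ('a \<times> 'b)"
  define Vf where "Vf x = fderiv V (fst x) (0, g (fst x))" for x :: "('a \<times> 'b) \<times> ('a \<times> 'b)"
  define Ax where "Ax x = fst (snd x) \<bullet> fderiv P (fst (fst x)) (f (fst x)) (fst (snd x)) +
    2 * (fst (snd x) \<bullet> P (fst (fst x)) (fderiv f (fst x) (snd x)))" for x :: "('a \<times> 'b) \<times> ('a \<times> 'b)"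
  define Af where "Af x = c x \<bullet> fderiv N (fst x) (0, g (fst x)) (c x) +
    2 * (c x \<bullet> N (fst x) (fderiv g (fst x) (snd x)))" for x
  define As where "As x = c x \<bullet> fderiv N (fst x) (f (fst x), 0) (c x) -
    2 * (c x \<bullet> N (fst x) (fderiv H (fst (fst x)) (f (fst x)) (fst (snd x)))) -
    2 * (c x \<bullet> N (fst x) (H (fst (fst x)) (fderiv f (fst x) (snd x))))" for x
  have cX: "continuous_on ?X (\<lambda>x. fst x)" "continuous_on ?X (\<lambda>x. fst (fst x))"
    "continuous_on ?X (\<lambda>x. snd x)"
    by (intro continuous_intros)+
  have inX: "fst x \<in> ?S" "fst (fst x) \<in> Bx" if "x \<in> ?X" for x
    using that by auto
  note comp = continuous_on_compose2[OF C1_on_imp_continuous_on]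
  have c0: "continuous_on ?X (\<lambda>x. N (fst x))" "continuous_on ?X (\<lambda>x. f (fst x))"
    "continuous_on ?X (\<lambda>x. g (fst x))" "continuous_on ?X (\<lambda>x. H (fst (fst x)))"
    "continuous_on ?X (\<lambda>x. P (fst (fst x)))"
    by (rule comp[OF N(1) cX(1)] comp[OF f cX(1)] comp[OF g cX(1)] comp[OF H cX(2)]
        comp[OF P(1) cX(2)]; force)+
  note D = continuous_on_fderiv[OF _ cX(1) inX(1)] continuous_on_fderiv[OF _ cX(2) inX(2)]
  have c1: "continuous_on ?X (\<lambda>x. fderiv f (fst x) (snd x))"
    "continuous_on ?X (\<lambda>x. fderiv g (fst x) (snd x))"
    "continuous_on ?X (\<lambda>x. fderiv N (fst x) (f (fst x), 0))"
    "continuous_on ?X (\<lambda>x. fderiv N (fst x) (0, g (fst x)))"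
    "continuous_on ?X (\<lambda>x. fderiv V (fst x) (f (fst x), 0))"
    "continuous_on ?X (\<lambda>x. fderiv V (fst x) (0, g (fst x)))"
    "continuous_on ?X (\<lambda>x. fderiv H (fst (fst x)) (f (fst x)))"
    "continuous_on ?X (\<lambda>x. fderiv P (fst (fst x)) (f (fst x)))"
    by (intro D(1)[OF f] D(1)[OF g] D(1)[OF N(1)] D(1)[OF V] D(2)[OF H] D(2)[OF P(1)]
        continuous_on_Pair continuous_on_const cX c0; assumption)+
  have cc: "continuous_on ?X c"
    unfolding c_def[abs_def] by (intro continuous_intros c0)
  have cont: "continuous_on ?X Wx" "continuous_on ?X Wz" "continuous_on ?X Vs" "continuous_on ?X Vf"
    "continuous_on ?X Ax" "continuous_on ?X Af" "continuous_on ?X As"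
    unfolding Wx_def[abs_def] Wz_def[abs_def] Vs_def[abs_def] Vf_def[abs_def] Ax_def[abs_def]
      Af_def[abs_def] As_def[abs_def]
    by (intro continuous_intros c0 c1 cc)+

  \<comment> \<open>The rate of V along (0, g) is the expression in \<open>fast\<close> at the
    vector c = g, hence strictly negative wherever g does not vanish.\<close>
  have Vf: "Vf x \<le> 0" "Vf x = 0 \<longleftrightarrow> g (fst x) = 0" if "x \<in> ?X" for x
  proof -
    have "fst x \<in> ?S" using that by auto
    note fast[OF this] dV[OF this]
    then show "Vf x \<le> 0" "Vf x = 0 \<longleftrightarrow> g (fst x) = 0"
      unfolding Vf_def by (cases "g (fst x) = 0"; force)+
  qed
  \<comment> \<open>Split (a, b) into (a, H a) and (0, \<zeta>): dg kills the first vector on the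
    slow manifold by tangency, and trivially when a = 0. These are the two ways in which
    \<open>Vf x * Wx x\<close> can vanish.\<close>
  have Af_eq: "Af x = c x \<bullet> fderiv N (fst x) (0, g (fst x)) (c x) +
      2 * (c x \<bullet> N (fst x) (fderiv g (fst x) (0, c x)))"
    if "x \<in> ?X" and z: "g (fst x) = 0 \<or> fst (snd x) = 0" for x
  proof -
    obtain p a b where x: "x = (p, a, b)" by (metis prod.collapse)
    have p: "p \<in> ?S" using that(1) x by auto
    have "fderiv g p (a, H (fst p) a) = 0"
      using z tangent[OF p, of a] linear_0[OF C1_on_linear[OF g p]] by (auto simp: x zero_prod_def)
    then have "fderiv g p (a, b) = fderiv g p (0, b - H (fst p) a)"
      using linear_add[OF C1_on_linear[OF g p], of "(a, H (fst p) a)" "(0, b - H (fst p) a)"] by simp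
    then show ?thesis by (simp add: Af_def c_def x)
  qed
  let ?Z = "?X \<inter> (\<lambda>x. g (fst x)) -` {0}"
  have Z: "compact ?Z"
  proof -
    have "closed ?Z"
      by (rule continuous_closed_preimage[OF c0(3) compact_imp_closed[OF X]]) simp
    then have "compact (?X \<inter> ?Z)" by (rule compact_Int_closed[OF X])
    then show ?thesis by (simp only: Int_left_absorb)
  qed
  have cZ: "continuous_on ?Z Ax" "continuous_on ?Z Af"
    using cont continuous_on_subset by blast+
  \<comment> \<open>On the manifold, \<open>Af\<close> vanishes only for \<zeta> = 0, that is for
    tangent vectors, and there \<open>Ax\<close> is the rate of the reduced system. A large weight
    therefore absorbs the coupling through the z-derivative of f.\<close>
  obtain K where K: "K > 0" "\<And>x k. x \<in> ?Z \<Longrightarrow> k \<ge> K \<Longrightarrow> Ax x + k * Af x < 0"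
  proof (rule compact_penalty[OF Z cZ])
    fix x assume x: "x \<in> ?Z"
    obtain p a b where x': "x = (p, a, b)" by (metis prod.collapse)
    have p: "p \<in> ?S" and gp: "g p = 0" using x x' by auto
    have Af: "Af x = c x \<bullet> fderiv N p (0, g p) (c x) + 2 * (c x \<bullet> N p (fderiv g p (0, c x)))"
      using Af_eq[of x] x by (auto simp: x')
    show "Af x \<le> 0"
      unfolding Af using fast[OF p, of "c x"] by (cases "c x = 0") auto
    assume "Af x = 0"
    then have "c x = 0" using fast[OF p, of "c x"] unfolding Af by force
    then have b: "b = H (fst p) a" by (simp add: c_def x')
    have "a \<noteq> 0"
      using x b by (auto simp: x' zero_prod_def[symmetric])
    then show "Ax x < 0"
      using slow[OF p gp, of a] by (simp add: Ax_def x' b)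
  qed blast

  \<comment> \<open>Coefficients of the powers 0, 1 and -1 of \<mu> in (Vs + Vf/\<mu>) (Wx + K \<mu>
    Wz) + Ax + K Af + K \<mu> As.\<close>
  define \<Phi>0 where "\<Phi>0 x = Vs x * Wx x + K * (Vf x * Wz x) + Ax x + K * Af x" for x
  define \<Phi>1 where "\<Phi>1 x = K * (Vs x * Wz x + As x)" for x
  define \<Phi>2 where "\<Phi>2 x = Vf x * Wx x" for x
  have Wx: "Wx x \<ge> 0" "Wx x = 0 \<longleftrightarrow> fst (snd x) = 0" and Wz: "Wz x \<ge> 0"
    if x: "x \<in> ?X" for x
  proof -
    have "fst (fst x) \<in> Bx" "fst x \<in> ?S" using x by auto
    then show "Wx x \<ge> 0" "Wx x = 0 \<longleftrightarrow> fst (snd x) = 0" "Wz x \<ge> 0"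
      using P(3)[of "fst (fst x)" "fst (snd x)"] N(3)[of "fst x" "c x"]
      unfolding Wx_def Wz_def
      by (cases "fst (snd x) = 0"; cases "c x = 0"; force)+
  qed
  obtain \<mu>0 where \<mu>0: "0 < \<mu>0" "\<mu>0 \<le> 1"
    "\<And>x \<mu>. x \<in> ?X \<Longrightarrow> 0 < \<mu> \<Longrightarrow> \<mu> \<le> \<mu>0 \<Longrightarrow> \<Phi>2 x / \<mu> + \<Phi>0 x + \<mu> * \<Phi>1 x < 0"
  proof (rule three_term_negative[OF X, of \<Phi>0 \<Phi>1 \<Phi>2])
    show "continuous_on ?X \<Phi>0" "continuous_on ?X \<Phi>1" "continuous_on ?X \<Phi>2"
      unfolding \<Phi>0_def[abs_def] \<Phi>1_def[abs_def] \<Phi>2_def[abs_def]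
      by (intro continuous_intros cont)+
    fix x assume x: "x \<in> ?X"
    show "\<Phi>2 x \<le> 0"
      unfolding \<Phi>2_def using Vf(1)[OF x] Wx(1)[OF x] by (rule mult_nonpos_nonneg)
    obtain p a b where x': "x = (p, a, b)" by (metis prod.collapse)
    have p: "p \<in> ?S" using x x' by auto
    assume "\<Phi>2 x = 0"
    then consider "g p = 0" | "a = 0"
      unfolding \<Phi>2_def using Vf(2)[OF x] Wx(2)[OF x] by (auto simp: x')
    then show "\<Phi>0 x < 0"
    proof cases
      case 1
      \<comment> \<open>V is quadratic in g, so its full derivative vanishes on the slow manifold
        and the exponential factor contributes nothing there.\<close>
      have "Vs x = 0" "Vf x = 0"
        by (simp_all add: Vs_def Vf_def x' dV[OF p] 1)
      moreover have "Ax x + K * Af x < 0"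
        using K(2)[of x K] x 1 by (auto simp: x')
      ultimately show ?thesis by (simp add: \<Phi>0_def)
    next
      case 2
      have "b \<noteq> 0" using x by (auto simp: x' 2 zero_prod_def[symmetric])
      then have "c x \<noteq> 0" by (simp add: c_def x' 2)
      then have "Af x < 0"
        using fast[OF p, of "c x"] Af_eq[OF x] by (simp add: x' 2)
      then have "K * Af x < 0"
        using K(1) by (simp add: mult_pos_neg)
      moreover have "K * (Vf x * Wz x) \<le> 0"
        using K(1) Vf(1)[OF x] Wz[OF x] by (simp add: mult_nonneg_nonpos mult_nonpos_nonneg)
      moreover have "Wx x = 0" "Ax x = 0"
        by (simp_all add: Wx_def Ax_def x' 2)
      ultimately show ?thesis by (simp add: \<Phi>0_def)
    qed
  qed blast

  have "\<exists>\<Theta> l. contracting_in (\<lambda>p t. (f p, (1 / \<mu>) *\<^sub>R g p)) ?S \<Theta> l" if \<mu>: "0 < \<mu>" "\<mu> \<le> \<mu>0" for \<mu>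
  proof (rule contracting_in_if_strict[OF S block_metric_C1[OF P(1) N(1) H V, of "K * \<mu>"]])
    show "C1_on (\<lambda>p. (f p, (1 / \<mu>) *\<^sub>R g p)) ?S"
      by (intro C1_on_Pair f C1_on_bounded_linear_comp[OF bounded_linear_scaleR_right] g)
    show "blinfun_adjoint (block_metric P N H V (K * \<mu>) p) = block_metric P N H V (K * \<mu>) p" for p
      by (rule block_metric_adjoint[OF P(2) N(2)])
    fix p w assume p: "p \<in> ?S"
    have p': "fst p \<in> Bx" using p by auto
    show "0 < w \<bullet> block_metric P N H V (K * \<mu>) p w" if w: "w \<noteq> 0"
    proof -
      let ?c = "snd w - H (fst p) (fst w)"
      have ge: "0 \<le> fst w \<bullet> P (fst p) (fst w)" "0 \<le> ?c \<bullet> N p ?c"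
        using P(3)[OF p', of "fst w"] N(3)[OF p, of ?c]
        by (cases "fst w = 0"; cases "?c = 0"; force)+
      have "0 < fst w \<bullet> P (fst p) (fst w) + K * \<mu> * (?c \<bullet> N p ?c)"
      proof (cases "fst w = 0")
        case True
        then have "?c \<noteq> 0" using w by (auto simp: prod_eq_iff)
        then show ?thesis
          using N(3)[OF p, of ?c] K(1) \<mu>(1) ge(1) by (intro add_nonneg_pos) auto
      next
        case False
        then show ?thesis
          using P(3)[OF p', of "fst w"] K(1) \<mu>(1) ge(2) by (intro add_pos_nonneg) auto
      qed
      then show ?thesis by (simp add: block_metric_form)
    qed
    assume w: "norm w = 1"
    let ?x = "(p, w)" and ?F = "\<lambda>p. (f p, (1 / \<mu>) *\<^sub>R g p)"
    have x: "?x \<in> ?X" using p w by simp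
    have dF: "fderiv ?F p w = (fderiv f p w, (1 / \<mu>) *\<^sub>R fderiv g p w)"
      by (subst fderiv_eq[OF has_derivative_Pair[OF C1_on_has_derivative[OF f p]
              has_derivative_scaleR_right[OF C1_on_has_derivative[OF g p]]]]) simp
    have F: "?F p = (f p, 0) + (1 / \<mu>) *\<^sub>R (0, g p)" by simp
    have lin: "fderiv V p (?F p) = Vs ?x + (1 / \<mu>) * Vf ?x"
      "fderiv N p (?F p) = fderiv N p (f p, 0) + (1 / \<mu>) *\<^sub>R fderiv N p (0, g p)"
      unfolding F
      using linear_add[OF C1_on_linear[OF V p]] linear_cmul[OF C1_on_linear[OF V p]]
        linear_add[OF C1_on_linear[OF N(1) p]] linear_cmul[OF C1_on_linear[OF N(1) p]]
      by (simp_all only: Vs_def Vf_def fst_conv real_scaleR_def)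
    have cx: "c ?x = snd w - H (fst p) (fst w)" by (simp add: c_def)
    have M1: "w \<bullet> fderiv (block_metric P N H V (K * \<mu>)) p (?F p) w = exp (V p) *
        ((Vs ?x + (1 / \<mu>) * Vf ?x) * (Wx ?x + K * \<mu> * Wz ?x) +
         (fst w \<bullet> fderiv P (fst p) (f p) (fst w) +
          K * \<mu> * (c ?x \<bullet> fderiv N p (f p, 0) (c ?x) +
            (1 / \<mu>) * (c ?x \<bullet> fderiv N p (0, g p) (c ?x)) -
            2 * (c ?x \<bullet> N p (fderiv H (fst p) (f p) (fst w))))))"
      unfolding block_metric_fderiv[OF P(1) N(1) H V N(2) p cx] lin
      by (simp add: Wx_def Wz_def blinfun.add_left blinfun.scaleR_left inner_add_right)
    have M2: "2 * (w \<bullet> block_metric P N H V (K * \<mu>) p (fderiv ?F p w)) = exp (V p) *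
        (2 * (fst w \<bullet> P (fst p) (fderiv f p w)) + K * \<mu> *
          ((1 / \<mu>) * (2 * (c ?x \<bullet> N p (fderiv g p w))) - 2 * (c ?x \<bullet> N p (H (fst p) (fderiv f p w)))))"
      unfolding block_metric_form dF cx[symmetric]
      by (simp add: blinfun.diff_right blinfun.scaleR_right inner_diff_right algebra_simps)
    have "w \<bullet> fderiv (block_metric P N H V (K * \<mu>)) p (?F p) w +
        2 * (w \<bullet> block_metric P N H V (K * \<mu>) p (fderiv ?F p w)) =
      exp (V p) * (\<Phi>2 ?x / \<mu> + \<Phi>0 ?x + \<mu> * \<Phi>1 ?x)"
      unfolding M1 M2 \<Phi>0_def \<Phi>1_def \<Phi>2_def Ax_def Af_def As_def
      using \<mu>(1) by (simp add: field_simps)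
    also have "\<dots> < 0"
      using \<mu>0(3)[OF x \<mu>] by (simp add: mult_pos_neg)
    finally show "w \<bullet> fderiv (block_metric P N H V (K * \<mu>)) p (?F p) w +
        2 * (w \<bullet> block_metric P N H V (K * \<mu>) p (fderiv ?F p w)) < 0" .
  qed
  then show ?thesis using that \<mu>0(1,2) by blast
qed

section \<open>Consequences of the contraction hypotheses\<close>

text \<open>Substituting v = \<Theta> w removes the inverse; positive definiteness makes \<Theta>
  injective, which is enough for \<open>inv\<close> to undo it on its range.\<close>

lemma contracting_inD:
  assumes "contracting_in F S \<Theta> l" "x \<in> S" "t > 0"
  shows "\<Theta> x t w \<bullet> (fderiv (\<lambda>(\<xi>, \<tau>). \<Theta> \<xi> \<tau>) (x, t) (F x t, 1) w + \<Theta> x t (fderiv (\<lambda>\<xi>. F \<xi> t) x w))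
    \<le> - l * (\<Theta> x t w \<bullet> \<Theta> x t w)"
proof -
  have pos: "v \<bullet> \<Theta> x t v > 0" if "v \<noteq> 0" for v
    using assms that unfolding contracting_in_def metric_on_def by fastforce
  have "inj (\<Theta> x t)"
  proof (rule injI)
    fix v v' assume "\<Theta> x t v = \<Theta> x t v'"
    then show "v = v'" using pos[of "v - v'"] by (auto simp: blinfun.diff_right)
  qed
  then have w: "inv (\<Theta> x t) (\<Theta> x t w) = w" by simp
  have "\<forall>v. let w = inv (blinfun_apply (\<Theta> x t)) v; J = fderiv (\<lambda>\<xi>. F \<xi> t) x
      in v \<bullet> (metric_rate F \<Theta> x t w + \<Theta> x t (J w)) \<le> - l * (v \<bullet> v)"
    using assms unfolding contracting_in_def by blast
  from this[rule_format, of "\<Theta> x t w"] show ?thesis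
    unfolding w Let_def metric_rate_def .
qed

lemma slow_metric:
  assumes S: "compact S" and c: "contracting_in (\<lambda>x t. F x) S \<Theta> l"
  obtains P where "C1_on P S" "\<And>x. blinfun_adjoint (P x) = P x"
    "\<And>x a. x \<in> S \<Longrightarrow> a \<noteq> 0 \<Longrightarrow> a \<bullet> P x a > 0"
    "\<And>x a. x \<in> S \<Longrightarrow> a \<noteq> 0 \<Longrightarrow> a \<bullet> fderiv P x (F x) a + 2 * (a \<bullet> P x (fderiv F x a)) < 0"
proof (rule time_average_metric[of "\<lambda>(x, t). \<Theta> x t" S l F "fderiv F"])
  show "metric_on (\<lambda>(x, t). \<Theta> x t) (S \<times> {0<..})" "l > 0"
    using c unfolding contracting_in_def by auto
  show "(case (x, t) of (x, t) \<Rightarrow> \<Theta> x t) w \<bullet> (fderiv (\<lambda>(x, t). \<Theta> x t) (x, t) (F x, 1) w +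
      (case (x, t) of (x, t) \<Rightarrow> \<Theta> x t) (fderiv F x w))
    \<le> - l * ((case (x, t) of (x, t) \<Rightarrow> \<Theta> x t) w \<bullet> (case (x, t) of (x, t) \<Rightarrow> \<Theta> x t) w)"
    if "x \<in> S" "0 < t" for x t w
    using contracting_inD[OF c that] by simp
qed (use S that in blast)+

text \<open>The averaging runs over the joint parameter p = (x, w) with the field (0, G p), which
  freezes x. Thus the resulting metric is also differentiable in x, as is required once x moves in
  the closed loop.\<close>

lemma fast_metric:
  fixes G :: "'a::euclidean_space \<times> 'b::euclidean_space \<Rightarrow> 'b"
  assumes Bx: "compact Bx" and Bz: "compact Bz" and G: "C1_on G (Bx \<times> Bz)"
    and c: "partially_contracting_in (\<lambda>w x t. G (x, w)) Bx Bz \<Theta> l"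
  obtains N where "C1_on N (Bx \<times> Bz)" "\<And>p. blinfun_adjoint (N p) = N p"
    "\<And>p a. p \<in> Bx \<times> Bz \<Longrightarrow> a \<noteq> 0 \<Longrightarrow> a \<bullet> N p a > 0"
    "\<And>p a. p \<in> Bx \<times> Bz \<Longrightarrow> a \<noteq> 0 \<Longrightarrow>
      a \<bullet> fderiv N p (0, G p) a + 2 * (a \<bullet> N p (fderiv G p (0, a))) < 0"
proof -
  define T where "T q = \<Theta> (fst (fst q)) (snd (fst q)) (snd q)" for q :: "('a \<times> 'b) \<times> real"
  \<comment> \<open>Positivity of \<open>l\<close> is asserted only through the members of
    \<open>Bx\<close>; an arbitrary positive rate stands in when there are none.\<close>
  define l' where "l' = (if Bx = {} then 1 else l)"
  have m: "metric_on (\<lambda>(y, w, t). \<Theta> y w t) (Bx \<times> Bz \<times> {0<..})"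
    and cx: "\<And>x. x \<in> Bx \<Longrightarrow> contracting_in (\<lambda>w t. G (x, w)) Bz (\<Theta> x) l"
    using c unfolding partially_contracting_in_def by auto
  have l: "l' > 0"
    using cx unfolding l'_def contracting_in_def by auto
  have T1: "C1_on T ((Bx \<times> Bz) \<times> {0<..})"
  proof -
    have "C1_on (\<lambda>q. (\<lambda>(y, w, t). \<Theta> y w t) (fst (fst q), snd (fst q), snd q)) ((Bx \<times> Bz) \<times> {0<..})"
    proof (rule C1_on_compose)
      show "C1_on (\<lambda>(y, w, t). \<Theta> y w t) (Bx \<times> Bz \<times> {0<..})"
        using m unfolding metric_on_def by blast
      show "C1_on (\<lambda>q. (fst (fst q), snd (fst q), snd q)) ((Bx \<times> Bz) \<times> {0<..})"
        by (intro C1_on_bounded_linear bounded_linear_Pair bounded_linear_fst_comp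
            bounded_linear_snd_comp bounded_linear_ident)
    qed auto
    then show ?thesis by (simp add: T_def[abs_def])
  qed
  have mT: "metric_on T ((Bx \<times> Bz) \<times> {0<..})"
    using m T1 unfolding metric_on_def T_def by fastforce
  have "T (p, t) w \<bullet> (fderiv T (p, t) ((0, G p), 1) w + T (p, t) (fderiv G p (0, w)))
      \<le> - l' * (T (p, t) w \<bullet> T (p, t) w)"
    if pS: "p \<in> Bx \<times> Bz" and t: "t > 0" for p t w
  proof -
    obtain x z where p: "p = (x, z)" "x \<in> Bx" "z \<in> Bz" using pS by auto
    have "((\<lambda>q. T ((x, fst q), snd q)) has_derivative (\<lambda>v. fderiv T ((x, z), t) ((0, fst v), snd v)))
        (at (z, t))"
    proof (rule has_derivative_compose[of "\<lambda>q. ((x, fst q), snd q)" "\<lambda>v. ((0, fst v), snd v)"])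
      show "((\<lambda>q. ((x, fst q), snd q)) has_derivative (\<lambda>v. ((0, fst v), snd v))) (at (z, t))"
        by (auto intro!: derivative_eq_intros)
      show "(T has_derivative fderiv T ((x, z), t)) (at ((x, fst (z, t)), snd (z, t)))"
        using C1_on_has_derivative[OF T1] p t by simp
    qed
    then have 1: "fderiv (\<lambda>(\<xi>, \<tau>). \<Theta> x \<xi> \<tau>) (z, t) (G (x, z), 1) = fderiv T ((x, z), t) ((0, G (x, z)), 1)"
      by (simp add: fderiv_eq case_prod_unfold T_def)
    have "((\<lambda>\<xi>. G (x, \<xi>)) has_derivative (\<lambda>v. fderiv G (x, z) (0, v))) (at z)"
    proof (rule has_derivative_compose[of "\<lambda>\<xi>. (x, \<xi>)" "\<lambda>v. (0, v)"])
      show "((\<lambda>\<xi>. (x, \<xi>)) has_derivative (\<lambda>v. (0, v))) (at z)"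
        by (auto intro!: derivative_eq_intros)
      show "(G has_derivative fderiv G (x, z)) (at (x, z))"
        using C1_on_has_derivative[OF G] p by simp
    qed
    then have 2: "fderiv (\<lambda>\<xi>. G (x, \<xi>)) z w = fderiv G (x, z) (0, w)"
      by (simp add: fderiv_eq)
    have "l' = l" using p by (auto simp: l'_def)
    then show ?thesis
      using contracting_inD[OF cx[OF p(2)] p(3) t, of w] unfolding 1 2 by (simp add: T_def p(1))
  qed
  from time_average_metric[OF mT compact_Times[OF Bx Bz] l this] show ?thesis
    using that by blast
qed

text \<open>The chain rule is written as a composition of operator fields, with the two coordinate
  embeddings as constants, so that the derivative of the root map is seen to be differentiable once
  more.\<close>

lemma smooth_feedback_derivative:
  fixes h :: "'a::euclidean_space \<Rightarrow> real \<Rightarrow> 'b::real_normed_vector"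
  assumes h: "smooth_on (\<lambda>(x, v). h x v) (S \<times> UNIV)" and u: "smooth_on u S"
  obtains H :: "'a \<Rightarrow> 'a \<Rightarrow>\<^sub>L 'b" where "C1_on H S"
    "\<And>x. x \<in> S \<Longrightarrow> ((\<lambda>x. h x (u x)) has_derivative H x) (at x)"
proof -
  let ?h = "\<lambda>(x, v). h x v"
  define E1 where "E1 = Blinfun (\<lambda>a :: 'a. (a, 0 :: real))"
  define E2 where "E2 = Blinfun (\<lambda>r :: real. (0 :: 'a, r))"
  have E: "E1 a = (a, 0)" "E2 r = (0, r)" for a r
    unfolding E1_def E2_def
    by (simp_all add: bounded_linear_Blinfun_apply bounded_linear_Pair bounded_linear_ident bounded_linear_zero)
  define H where "H x = Blinfun (fderiv ?h (x, u x)) o\<^sub>L (E1 + (E2 o\<^sub>L Blinfun (fderiv u x)))" for x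
  have u1: "C1_on u S" and h1: "C1_on ?h (S \<times> UNIV)"
    using u h by (auto intro: smooth_on_imp_C1_on)
  have xu: "C1_on (\<lambda>x. (x, u x)) S"
    by (intro C1_on_Pair C1_on_ident u1)
  have "C1_on H S"
    unfolding H_def[abs_def]
    by (intro C1_on_bilinear[OF bounded_bilinear_blinfun_compose] C1_on_add C1_on_const
        smooth_on_fderiv_C1[OF u] C1_on_compose[OF smooth_on_fderiv_C1[OF h] xu]) auto
  moreover have "((\<lambda>x. h x (u x)) has_derivative H x) (at x)" if x: "x \<in> S" for x
  proof -
    have du: "(u has_derivative fderiv u x) (at x)"
      by (rule C1_on_has_derivative[OF u1 x])
    have dh: "(?h has_derivative fderiv ?h (x, u x)) (at (x, u x))"
      using C1_on_has_derivative[OF h1] x by simp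
    have "((\<lambda>x. ?h (x, u x)) has_derivative (\<lambda>v. fderiv ?h (x, u x) (v, fderiv u x v))) (at x)"
      by (rule has_derivative_compose[OF has_derivative_Pair[OF has_derivative_ident du] dh])
    moreover have "blinfun_apply (H x) = (\<lambda>v. fderiv ?h (x, u x) (v, fderiv u x v))"
      by (rule ext) (simp add: H_def E blinfun.add_left
          bounded_linear_Blinfun_apply[OF has_derivative_bounded_linear[OF du]]
          bounded_linear_Blinfun_apply[OF has_derivative_bounded_linear[OF dh]])
    ultimately show ?thesis by simp
  qed
  ultimately show ?thesis using that by blast
qed

text \<open>The chain rule along the slow manifold, where (v, H v) is a tangent vector. Applied to g
  it gives tangency, and applied to f it identifies the restricted Jacobian with that of the reduced
  system. The boundary of \<open>S\<close> is covered by the uniqueness of derivatives on the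
  closure of the interior.\<close>

lemma fderiv_along_graph:
  fixes \<phi> :: "'a::euclidean_space \<times> 'b::euclidean_space \<Rightarrow> 'c::real_normed_vector"
  assumes \<phi>: "C1_on \<phi> (S \<times> T)" and h: "C1_on h S" "\<And>x. x \<in> S \<Longrightarrow> h x \<in> T"
    and x: "x \<in> S" "(h has_derivative H) (at x)"
    and \<psi>: "C1_on \<psi> S" "\<And>\<xi>. \<xi> \<in> S \<Longrightarrow> \<phi> (\<xi>, h \<xi>) = \<psi> \<xi>"
    and S: "closed S" "S \<subseteq> closure (interior S)"
  shows "fderiv \<phi> (x, h x) (v, H v) = fderiv \<psi> x v"
proof -
  have d: "(\<phi> has_derivative fderiv \<phi> (x, h x)) (at (x, h x))"
    using C1_on_has_derivative[OF \<phi>] x(1) h(2) by simp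
  have "fderiv (\<lambda>\<xi>. \<phi> (\<xi>, h \<xi>)) x = (\<lambda>v. fderiv \<phi> (x, h x) (v, H v))"
    by (rule fderiv_eq, rule has_derivative_compose[OF has_derivative_Pair[OF has_derivative_ident x(2)] d])
  moreover have "fderiv (\<lambda>\<xi>. \<phi> (\<xi>, h \<xi>)) x = fderiv \<psi> x"
  proof (rule C1_on_fderiv_unique[OF _ \<psi> S x(1)])
    show "C1_on (\<lambda>\<xi>. \<phi> (\<xi>, h \<xi>)) S"
      by (rule C1_on_compose[OF \<phi> C1_on_Pair[OF C1_on_ident h(1)]]) (use h(2) in auto)
  qed
  ultimately show ?thesis by metis
qed

theorem theorem2:
  fixes f :: "real ^ 'n \<Rightarrow> real ^ 'm \<Rightarrow> real \<Rightarrow> real ^ 'n"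
    and g :: "real ^ 'n \<Rightarrow> real ^ 'm \<Rightarrow> real \<Rightarrow> real ^ 'm"
    and h :: "real ^ 'n \<Rightarrow> real \<Rightarrow> real ^ 'm"
    and Bx :: "(real ^ 'n) set" and Bz :: "(real ^ 'm) set"
    and u1 :: "real ^ 'n \<Rightarrow> real" and u2 :: "real ^ 'n \<Rightarrow> real ^ 'm \<Rightarrow> real"
    and \<Theta>x :: "real ^ 'n \<Rightarrow> real \<Rightarrow> (real ^ 'n) \<Rightarrow>\<^sub>L (real ^ 'n)"
    and \<Theta>z :: "real ^ 'n \<Rightarrow> real ^ 'm \<Rightarrow> real \<Rightarrow> (real ^ 'm) \<Rightarrow>\<^sub>L (real ^ 'm)"
    and lx d2 dq :: real
  assumes Bx: "compact Bx" "Bx \<subseteq> closure (interior Bx)"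
    and Bz: "compact Bz"
    and f: "smooth_on (\<lambda>(x, z, v). f x z v) (Bx \<times> Bz \<times> UNIV)"
      "\<exists>L. L-lipschitz_on (Bx \<times> Bz \<times> UNIV) (\<lambda>(x, z, v). f x z v)"
    and g: "smooth_on (\<lambda>(x, z, v). g x z v) (Bx \<times> Bz \<times> UNIV)"
      "\<exists>L. L-lipschitz_on (Bx \<times> Bz \<times> UNIV) (\<lambda>(x, z, v). g x z v)"
    and h: "smooth_on (\<lambda>(x, v). h x v) (Bx \<times> UNIV)"
      "\<exists>L. L-lipschitz_on (Bx \<times> UNIV) (\<lambda>(x, v). h x v)"
    and root: "\<And>x. x \<in> Bx \<Longrightarrow> h x (u1 x) \<in> Bz \<and> g x (h x (u1 x)) (u1 x) = 0"
    and root_unique: "\<And>x z. x \<in> Bx \<Longrightarrow> z \<in> Bz \<Longrightarrow> g x z (u1 x + u2 x z) = 0 \<Longrightarrow> z = h x (u1 x)"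
    and u1: "smooth_on u1 Bx"
    and slow: "contracting_in (\<lambda>x t. f x (h x (u1 x)) (u1 x)) Bx \<Theta>x lx"
    and u2: "smooth_on (\<lambda>(x, z). u2 x z) (Bx \<times> Bz)"
      "\<And>x z. x \<in> Bx \<Longrightarrow> z \<in> Bz \<Longrightarrow> norm (u2 x z) \<le> d2 * norm (z - h x (u1 x))"
    and fast: "\<And>\<mu>. \<mu> \<in> {0<..1} \<Longrightarrow>
      \<exists>lz. partially_contracting_in (\<lambda>w x t. (1 / \<mu>) *\<^sub>R g x w (u1 x + u2 x w)) Bx Bz \<Theta>z lz"
    and dq: "dq > 0"
      "\<And>x z. x \<in> Bx \<Longrightarrow> z \<in> Bz \<Longrightarrow>
        onorm (frechet_derivative (Q_map f h u1 (\<lambda>x z. u1 x + u2 x z) x) (at z)) \<le> dq"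
  shows "\<exists>u \<mu>s. smooth_on (\<lambda>(x, z). u x z) (Bx \<times> Bz) \<and> 0 < \<mu>s \<and> \<mu>s \<le> 1 \<and>
    (\<forall>\<mu>\<in>{0<..\<mu>s}. \<exists>\<Theta> l. contracting_in (\<lambda>p t. closed_loop f g u \<mu> p) (Bx \<times> Bz) \<Theta> l)"
proof -
  let ?S = "Bx \<times> Bz"
  define uc where "uc x z = u1 x + u2 x z" for x z
  define fc where "fc p = f (fst p) (snd p) (uc (fst p) (snd p))" for p
  define gc where "gc p = g (fst p) (snd p) (uc (fst p) (snd p))" for p
  define hb where "hb x = h x (u1 x)" for x
  define fr where "fr x = f x (hb x) (u1 x)" for x
  have uc: "smooth_on (\<lambda>(x, z). uc x z) ?S"
    using smooth_on_add[OF smooth_on_fst[OF u1] u2(1)] by (simp add: uc_def case_prod_unfold)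
  then have uc1: "C1_on (\<lambda>p. uc (fst p) (snd p)) ?S"
    using smooth_on_imp_C1_on by (simp add: case_prod_unfold)
  have u1': "C1_on u1 Bx"
    by (rule smooth_on_imp_C1_on[OF u1])
  obtain H where H: "C1_on H Bx" "\<And>x. x \<in> Bx \<Longrightarrow> (hb has_derivative blinfun_apply (H x)) (at x)"
    using smooth_feedback_derivative[OF h(1) u1] unfolding hb_def[abs_def] by blast
  have hb1: "C1_on hb Bx"
    using C1_on_compose[OF smooth_on_imp_C1_on[OF h(1)] C1_on_Pair[OF C1_on_ident u1']]
    by (simp add: hb_def[abs_def])
  have p1: "C1_on (\<lambda>p. (fst p, snd p, uc (fst p) (snd p))) ?S"
    by (intro C1_on_Pair C1_on_fst C1_on_snd uc1)
  have fc1: "C1_on fc ?S"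
    using C1_on_compose[OF smooth_on_imp_C1_on[OF f(1)] p1] by (auto simp: fc_def[abs_def])
  have gc1: "C1_on gc ?S"
    using C1_on_compose[OF smooth_on_imp_C1_on[OF g(1)] p1] by (auto simp: gc_def[abs_def])
  \<comment> \<open>The bound on \<open>u2\<close> forces it to vanish at the root, so that on the
    slow manifold the closed loop carries the control \<open>u1\<close> alone and restricts to the
    reduced system.\<close>
  have hbz: "hb x \<in> Bz" and u20: "u2 x (hb x) = 0" if "x \<in> Bx" for x
    using root[OF that] u2(2)[OF that, of "hb x"] by (auto simp: hb_def)
  have fr1: "C1_on fr Bx"
    using C1_on_compose[OF smooth_on_imp_C1_on[OF f(1)] C1_on_Pair[OF C1_on_ident C1_on_Pair[OF hb1 u1']]]
      hbz by (auto simp: fr_def[abs_def])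
  have fc_fr: "fc (x, hb x) = fr x" and gc0: "gc (x, hb x) = 0" if "x \<in> Bx" for x
    using root[OF that] u20[OF that] by (auto simp: fc_def gc_def fr_def uc_def hb_def)
  \<comment> \<open>Uniqueness of the root makes the zero set of \<open>gc\<close> exactly the graph
    of \<open>hb\<close>; hence every point with \<open>gc p = 0\<close> is one at which the reduced
    system is informative.\<close>
  have on_root: "snd p = hb (fst p)" if "p \<in> ?S" "gc p = 0" for p
    using root_unique[of "fst p" "snd p"] that by (auto simp: gc_def uc_def hb_def)
  note graph = fderiv_along_graph[OF _ hb1 hbz _ H(2) _ _ compact_imp_closed[OF Bx(1)] Bx(2)]
  have "contracting_in (\<lambda>x t. fr x) Bx \<Theta>x lx"
    using slow by (simp add: fr_def hb_def)
  from slow_metric[OF Bx(1) this] obtain P where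
    P: "C1_on P Bx" "\<And>x. blinfun_adjoint (P x) = P x"
      "\<And>x a. x \<in> Bx \<Longrightarrow> a \<noteq> 0 \<Longrightarrow> a \<bullet> P x a > 0"
      "\<And>x a. x \<in> Bx \<Longrightarrow> a \<noteq> 0 \<Longrightarrow> a \<bullet> fderiv P x (fr x) a + 2 * (a \<bullet> P x (fderiv fr x a)) < 0"
    by blast
  \<comment> \<open>At \<mu> = 1 the auxiliary system is w' = gc (x, w) itself. The metric obtained
    from it serves for all small \<mu>, which re-enters as the factor 1/\<mu> of the closed
    loop.\<close>
  obtain lz where "partially_contracting_in (\<lambda>w x t. gc (x, w)) Bx Bz \<Theta>z lz"
    using fast[of 1] by (auto simp: gc_def uc_def)
  from fast_metric[OF Bx(1) Bz gc1 this] obtain N where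
    N: "C1_on N ?S" "\<And>p. blinfun_adjoint (N p) = N p"
      "\<And>p a. p \<in> ?S \<Longrightarrow> a \<noteq> 0 \<Longrightarrow> a \<bullet> N p a > 0"
      "\<And>p a. p \<in> ?S \<Longrightarrow> a \<noteq> 0 \<Longrightarrow> a \<bullet> fderiv N p (0, gc p) a + 2 * (a \<bullet> N p (fderiv gc p (0, a))) < 0"
    by blast
  have "closed_loop f g uc \<mu> = (\<lambda>p. (fc p, (1 / \<mu>) *\<^sub>R gc p))" for \<mu>
    by (auto simp: closed_loop_def fc_def gc_def)
  then have concl: ?thesis if "0 < \<mu>s" "\<mu>s \<le> 1"
    "\<And>\<mu>. 0 < \<mu> \<Longrightarrow> \<mu> \<le> \<mu>s \<Longrightarrow>
      \<exists>\<Theta> l. contracting_in (\<lambda>p t. (fc p, (1 / \<mu>) *\<^sub>R gc p)) ?S \<Theta> l" for \<mu>s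
    using uc that by (intro exI[of _ uc] exI[of _ \<mu>s]) auto
  show ?thesis
  proof (rule two_time_scale_contraction[OF Bx(1) Bz fc1 gc1 H(1) P(1-3) N(1-3) _ _ N(4)])
    fix p :: "(real ^ 'n) \<times> (real ^ 'm)" and a :: "real ^ 'n"
    assume p: "p \<in> ?S" and z: "gc p = 0"
    have x: "fst p \<in> Bx" using p by auto
    have p': "p = (fst p, hb (fst p))"
      using on_root[OF p z] by (simp add: prod_eq_iff)
    have "fderiv gc (fst p, hb (fst p)) (a, H (fst p) a) = fderiv (\<lambda>x. 0) (fst p) a"
      by (rule graph[OF gc1 _ x x C1_on_const gc0])
    then show "fderiv gc p (a, H (fst p) a) = 0"
      using p' by simp
    have "fderiv fc (fst p, hb (fst p)) (a, H (fst p) a) = fderiv fr (fst p) a"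
      by (rule graph[OF fc1 _ x x fr1 fc_fr])
    then have "fderiv fc p (a, H (fst p) a) = fderiv fr (fst p) a" "fc p = fr (fst p)"
      using p' fc_fr[OF x] by simp_all
    then show "a \<bullet> fderiv P (fst p) (fc p) a + 2 * (a \<bullet> P (fst p) (fderiv fc p (a, H (fst p) a))) < 0"
      if "a \<noteq> 0"
      using P(4)[OF x that] by simp
  next
    fix \<mu>s :: real
    assume "0 < \<mu>s" "\<mu>s \<le> 1" "\<And>\<mu>. 0 < \<mu> \<Longrightarrow> \<mu> \<le> \<mu>s \<Longrightarrow>
      \<exists>\<Theta> l. contracting_in (\<lambda>p t. (fc p, (1 / \<mu>) *\<^sub>R gc p)) ?S \<Theta> l"
    then show ?thesis by (rule concl)
  qed assumption+
qed

end
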